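(* Let $k$ be a positive integer such that $k \in \{7, 8, 9, 11\}$ or $k \equiv 5 \pmod 8$. Then $$m(k,2) \geq 3(k-1) + 1.$$
   Context: An $[n,k]_2$-code is a linear subspace of $\mathbb{F}_2^n$ of dimension $k$; $n$ is its length. The support of $x \in \mathbb{F}_2^n$ is $\sigma(x) = \{i \mid x_i \neq 0\}$. A nonzero codeword $c$ of a code $\mathcal{C}$ is minimal if there is no nonzero codeword $c' \in \mathcal{C}$ with $\sigma(c') \subsetneq \sigma(c)$. A code is minimal if all of its nonzero codewords are minimal. $m(k,2)$ denotes the length of the shortest minimal codes of dimension $k$ over $\mathbb{F}_2$, i.e. the smallest $n$ such that there is a minimal $[n,k]_2$-code. *)

theory Defs
  imports "HOL-Library.Z2" "Jordan_Normal_Form.VS_Connect"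
begin

text \<open>
  The field with two elements is the type \<^typ>\<open>bit\<close>, and \<open>F_2^n\<close> is the vector space
  \<^term>\<open>module_vec TYPE(bit) n\<close>, whose coordinates are indexed by \<open>0, ..., n - 1\<close>.
\<close>

definition binary_code :: "nat \<Rightarrow> nat \<Rightarrow> bit vec set \<Rightarrow> bool" where
  "binary_code n k C \<longleftrightarrow>
     VectorSpace.subspace class_ring C (module_vec TYPE(bit) n) \<and>
     vectorspace.dim class_ring ((module_vec TYPE(bit) n)\<lparr>carrier := C\<rparr>) = k"

definition vec_support :: "bit vec \<Rightarrow> nat set" where
  "vec_support x = {i. i < dim_vec x \<and> x $ i \<noteq> 0}"

definition minimal_codeword :: "nat \<Rightarrow> bit vec set \<Rightarrow> bit vec \<Rightarrow> bool" where
  "minimal_codeword n C c \<longleftrightarrow>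
     c \<in> C \<and> c \<noteq> 0\<^sub>v n \<and>
     \<not> (\<exists>c'\<in>C. c' \<noteq> 0\<^sub>v n \<and> vec_support c' \<subset> vec_support c)"

definition minimal_code :: "nat \<Rightarrow> bit vec set \<Rightarrow> bool" where
  "minimal_code n C \<longleftrightarrow> (\<forall>c\<in>C. c \<noteq> 0\<^sub>v n \<longrightarrow> minimal_codeword n C c)"

text \<open>
  Binary minimal codes of every dimension exist (for \<open>k \<ge> 1\<close>, the simplex code of
  length \<open>2^k - 1\<close>), so the minimum below is taken over a nonempty set.
\<close>

definition min_length_minimal_code :: "nat \<Rightarrow> nat" where
  "min_length_minimal_code k =
     (LEAST n. \<exists>C. binary_code n k C \<and> minimal_code n C)"

end

theory Submission
  imports Defs
begin

text \<open>
  Identify words with their supports; a minimal code is then an intersecting family, so that restriction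
  to the support of a nonzero word is injective and all weights are at least \<open>k = m + 1\<close>. Let \<open>c\<close> have
  maximal weight. Some word contains \<open>m\<close> independent coordinates outside \<open>c\<close>, and maximality of \<open>c\<close> makes
  the length at least \<open>3 m\<close>. In case of equality the coordinates split into three blocks of size \<open>m\<close> whose
  pairwise unions are codewords, and each block meets the code in all of its subsets. Adding these
  codewords to a word with block weights \<open>a, b, c\<close> bounds all sign combinations of
  \<open>m - 2 a, m - 2 b, m - 2 c\<close>.

  A word with \<open>a = 1\<close> has \<open>b + c = m\<close> and \<open>\<bar>b - c\<bar> \<le> 1\<close>. For even \<open>m\<close> all three block weights have the
  same parity, so \<open>b = c = m / 2\<close> is odd, which excludes \<open>4 dvd m\<close>; moreover the words with even block
  weights are doubly even. This leaves so few weight types for \<open>m = 6\<close> and \<open>m = 10\<close> that the second moments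
  of the block deviations, respectively second moments and the nonnegative mixed third moment, are
  contradictory. For \<open>m = 7\<close> the words with even block weights form a code of size 64 with weights
  8, 10, 12, 14. Let \<open>p\<close> be the number of weight 10. The moments give \<open>p \<le> 21\<close> and \<open>p mod 8 = 7\<close>, while
  orthogonality relations between the words missing one point of a block give \<open>p \<ge> 21\<close>.
\<close>

section \<open>Linear and intersecting families\<close>

definition linear_family :: "'a set set \<Rightarrow> bool" where
  "linear_family C \<longleftrightarrow> {} \<in> C \<and> (\<forall>c\<in>C. \<forall>d\<in>C. sym_diff c d \<in> C)"

lemma linear_familyD:
  assumes "linear_family C"
  shows "{} \<in> C" "c \<in> C \<Longrightarrow> d \<in> C \<Longrightarrow> sym_diff c d \<in> C"
  using assms by (auto simp: linear_family_def)

lemma card_sym_diff_int: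
  assumes "finite A" "finite B"
  shows "int (card (sym_diff A B)) = int (card A) + int (card B) - 2 * int (card (A \<inter> B))"
proof -
  have "card (sym_diff A B) = card (A - B) + card (B - A)"
    using assms by (intro card_Un_disjoint) auto
  moreover have "card A = card (A - B) + card (A \<inter> B)"
    using card_Int_Diff[OF assms(1), of B] by simp
  moreover have "card B = card (B - A) + card (A \<inter> B)"
    using card_Int_Diff[OF assms(2), of A] by (simp add: Int_commute)
  ultimately show ?thesis by simp
qed

lemma even_card_sym_diff:
  assumes "finite A" "finite B"
  shows "even (card (sym_diff A B)) \<longleftrightarrow> (even (card A) \<longleftrightarrow> even (card B))"
  using card_sym_diff_int[OF assms] by presburger

lemma sym_diff_Int: "sym_diff A B \<inter> S = sym_diff (A \<inter> S) (B \<inter> S)"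
  by auto

lemma sym_diff_cancel: "sym_diff A (sym_diff A B) = B"
  by auto

lemma card_le_mult_card_image:
  assumes "finite C" and "\<And>x. x \<in> C \<Longrightarrow> card {y \<in> C. f y = f x} \<le> r"
  shows "card C \<le> r * card (f ` C)"
proof -
  have "card C = (\<Sum>y\<in>f ` C. card {x \<in> C. f x = y})"
    using sum.image_gen[OF assms(1), of "\<lambda>_. 1::nat" f] by simp
  also have "\<dots> \<le> (\<Sum>y\<in>f ` C. r)"
    using assms(2) by (intro sum_mono) auto
  finally show ?thesis by (simp add: mult.commute)
qed

text \<open>\<open>P\<close> acts as a homomorphism to a group of order two, so adding
  \<open>d\<close> exchanges its kernel with the complement.\<close>

lemma linear_family_half:
  assumes fin: "finite C" and lin: "linear_family C"
    and add: "\<And>c d. c \<in> C \<Longrightarrow> d \<in> C \<Longrightarrow> P (sym_diff c d) \<longleftrightarrow> (P c \<longleftrightarrow> P d)"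
    and d: "d \<in> C" "\<not> P d"
  shows "card C = 2 * card {c \<in> C. P c}"
proof -
  have "bij_betw (sym_diff d) {c \<in> C. P c} {c \<in> C. \<not> P c}"
    using d add linear_familyD[OF lin]
    by (intro bij_betw_byWitness[where f' = "sym_diff d"]) (auto simp: sym_diff_cancel)
  then have *: "card {c \<in> C. \<not> P c} = card {c \<in> C. P c}"
    using bij_betw_same_card by fastforce
  have "C = {c \<in> C. P c} \<union> {c \<in> C. \<not> P c}" by auto
  then have "card C = card {c \<in> C. P c} + card {c \<in> C. \<not> P c}"
    using fin by (metis (no_types, lifting) card_Un_disjoint disjoint_iff finite_Un mem_Collect_eq)
  with * show "card C = 2 * card {c \<in> C. P c}" by simp
qed

text \<open>A minimal set of coordinates on which no two members agree is an information set.\<close>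

lemma linear_family_information_set:
  assumes U: "finite U" and V: "V \<subseteq> Pow U" and lin: "linear_family V"
  obtains S v where "S \<subseteq> U" "card V \<le> 2 ^ card S" "v \<in> V" "S \<subseteq> v"
proof -
  define P where "P S \<longleftrightarrow> S \<subseteq> U \<and> inj_on (\<lambda>v. v \<inter> S) V" for S
  have "P U" using V by (auto simp: P_def inj_on_def)
  then obtain S where S: "P S" and min: "\<And>S'. P S' \<Longrightarrow> card S \<le> card S'"
    using ex_has_least_nat[of P U card] by blast
  have finS: "finite S" using S U by (auto simp: P_def intro: finite_subset)
  \<comment> \<open>By minimality of \<open>S\<close>, two members agree once \<open>i\<close> is
    dropped; on \<open>S\<close> they differ in \<open>i\<close> only, so their sum has trace
    \<open>{i}\<close>. These traces then generate all others, including \<open>S\<close>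
    itself.\<close>
  have single: "\<exists>v\<in>V. v \<inter> S = {i}" if i: "i \<in> S" for i
  proof -
    have "card (S - {i}) < card S"
      using finS i by (metis card_Diff1_less)
    then have "\<not> P (S - {i})" using min by fastforce
    then have "\<not> inj_on (\<lambda>v. v \<inter> (S - {i})) V" using S by (auto simp: P_def)
    then obtain v w where vw: "v \<in> V" "w \<in> V" "v \<noteq> w" "v \<inter> (S - {i}) = w \<inter> (S - {i})"
      by (auto simp: inj_on_def)
    have "v \<inter> S \<noteq> w \<inter> S" using S vw by (auto simp: P_def inj_on_def)
    then have "sym_diff v w \<inter> S = {i}" using vw(4) i by blast
    then show ?thesis using linear_familyD(2)[OF lin vw(1,2)] by blast
  qed
  have "\<exists>v\<in>V. v \<inter> S = T" if "finite T" "T \<subseteq> S" for T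
    using that
  proof (induction T)
    case empty
    then show ?case using linear_familyD(1)[OF lin] by blast
  next
    case (insert i T)
    then obtain v where v: "v \<in> V" "v \<inter> S = T" by auto
    obtain w where w: "w \<in> V" "w \<inter> S = {i}" using single insert.prems by blast
    have "sym_diff v w \<inter> S = insert i T" using v w insert.hyps by auto
    then show ?case using linear_familyD(2)[OF lin v(1) w(1)] by blast
  qed
  then obtain v where v: "v \<in> V" "v \<inter> S = S" using finS by blast
  have "card V = card ((\<lambda>v. v \<inter> S) ` V)" using S by (simp add: P_def card_image)
  also have "\<dots> \<le> card (Pow S)" using finS by (intro card_mono) auto
  finally have "card V \<le> 2 ^ card S" using finS by (simp add: card_Pow)
  then show ?thesis using that[of S v] S v by (auto simp: P_def)
qed

section \<open>Intersecting families and the length bound\<close>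

definition intersecting :: "'a set set \<Rightarrow> bool" where
  "intersecting C \<longleftrightarrow> (\<forall>c\<in>C. \<forall>d\<in>C. c \<noteq> {} \<longrightarrow> d \<noteq> {} \<longrightarrow> c \<inter> d \<noteq> {})"

lemma intersectingD:
  "intersecting C \<Longrightarrow> c \<in> C \<Longrightarrow> d \<in> C \<Longrightarrow> c \<inter> d = {} \<Longrightarrow> c = {} \<or> d = {}"
  by (auto simp: intersecting_def)

text \<open>The rest \<open>d - c\<close> is the word \<open>sym_diff c d\<close>, which is disjoint
  from \<open>c\<close>.\<close>

lemma intersecting_subset:
  assumes "linear_family C" "intersecting C" "c \<in> C" "d \<in> C" "c \<subseteq> d"
  shows "c = {} \<or> c = d"
proof -
  have "c \<inter> sym_diff c d = {}" using assms(5) by auto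
  then have "c = {} \<or> sym_diff c d = {}"
    using intersectingD[OF assms(2,3) linear_familyD(2)[OF assms(1,3,4)]] by simp
  then show ?thesis by auto
qed

text \<open>A word that vanishes on \<open>c\<close> is zero, so each word is determined by its
  restriction to \<open>c\<close>.\<close>

lemma intersecting_card_ge:
  assumes U: "finite U" "C \<subseteq> Pow U" and lin: "linear_family C" and int: "intersecting C"
    and c: "c \<in> C" "c \<noteq> {}" and card: "2 ^ k \<le> card C"
  shows "k \<le> card c"
proof -
  have finc: "finite c" using U c(1) by (meson PowD finite_subset subsetD)
  have "inj_on (\<lambda>d. d \<inter> c) C"
  proof (rule inj_onI)
    fix d e assume de: "d \<in> C" "e \<in> C" "d \<inter> c = e \<inter> c"
    then have "sym_diff d e \<inter> c = {}" by blast
    then have "sym_diff d e = {}"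
      using intersectingD[OF int linear_familyD(2)[OF lin de(1,2)] c(1)] c(2) by simp
    then show "d = e" by blast
  qed
  then have "card C = card ((\<lambda>d. d \<inter> c) ` C)" by (simp add: card_image)
  also have "\<dots> \<le> card (Pow c)" using finc by (intro card_mono) auto
  finally have "card C \<le> 2 ^ card c" using finc by (simp add: card_Pow)
  then have "(2::nat) ^ k \<le> 2 ^ card c" using card by linarith
  then show ?thesis by (simp add: power_increasing_iff)
qed

text \<open>
  The extremal configuration: the blocks \<open>X, Y, Z\<close> are the complements of three words of maximal
  weight with sum zero.
\<close>

locale three_blocks =
  fixes C :: "'a set set" and X Y Z :: "'a set" and m :: nat
  assumes fin: "finite X" "finite Y" "finite Z"
    and card_blocks: "card X = m" "card Y = m" "card Z = m"
    and disj: "X \<inter> Y = {}" "Y \<inter> Z = {}" "X \<inter> Z = {}"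
    and sub: "C \<subseteq> Pow (X \<union> Y \<union> Z)"
    and lin: "linear_family C" and inter: "intersecting C"
    and pairs: "Y \<union> Z \<in> C" "X \<union> Z \<in> C" "X \<union> Y \<in> C"
    and card_ge: "2 ^ (m + 1) \<le> card C"
    and weight_le: "c \<in> C \<Longrightarrow> card c \<le> 2 * m"

text \<open>Projecting away from a word \<open>D\<close> of maximal weight loses one dimension only.
  A word \<open>c\<close> that contains an information set of the projection has at least
  \<open>m\<close> points outside \<open>D\<close>, and comparing \<open>c\<close> and
  \<open>sym_diff c D\<close> with \<open>D\<close> makes \<open>D \<inter> c\<close> and
  \<open>D - c\<close> as large.\<close>

lemma intersecting_length:
  assumes U: "finite U" "card U \<le> 3 * m" and C: "C \<subseteq> Pow U"
    and lin: "linear_family C" and inter: "intersecting C" and card: "2 ^ (m + 1) \<le> card C"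
  obtains X Y Z where "three_blocks C X Y Z m"
proof -
  have finC: "finite C" using U C by (meson finite_Pow_iff finite_subset)
  have finw: "finite c" if "c \<in> C" for c using that U C by (meson PowD finite_subset subsetD)
  define D where "D = (ARG_MAX card c. c \<in> C)"
  have D: "D \<in> C" and max: "\<And>c. c \<in> C \<Longrightarrow> card c \<le> card D"
  proof -
    have *: "{} \<in> C" using linear_familyD(1)[OF lin] .
    have "\<forall>c. c \<in> C \<longrightarrow> card c < card U + 1"
      using C U by (auto simp: less_Suc_eq_le intro!: card_mono)
    from arg_max_nat_lemma[of "\<lambda>c. c \<in> C", OF * this]
    show "D \<in> C" "\<And>c. c \<in> C \<Longrightarrow> card c \<le> card D" by (auto simp: D_def)
  qed
  have "\<exists>c\<in>C. c \<noteq> {}"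
  proof (rule ccontr)
    assume "\<not> ?thesis"
    then have "C \<subseteq> {{}}" by auto
    then have "card C \<le> 1" using card_mono[of "{{}}" C] by simp
    moreover have "(2::nat) \<le> 2 ^ (m + 1)" by simp
    ultimately show False using card by linarith
  qed
  then have Dne: "D \<noteq> {}" using max finw by fastforce
  define V where "V = (\<lambda>c. c - D) ` C"
  have linV: "linear_family V"
    unfolding linear_family_def V_def
  proof (intro conjI ballI)
    show "{} \<in> (\<lambda>c. c - D) ` C" using linear_familyD(1)[OF lin] by force
    fix c d assume "c \<in> (\<lambda>c. c - D) ` C" "d \<in> (\<lambda>c. c - D) ` C"
    then obtain a b where "a \<in> C" "b \<in> C" "c = a - D" "d = b - D" by auto
    then show "sym_diff c d \<in> (\<lambda>c. c - D) ` C"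
      using linear_familyD(2)[OF lin, of a b] by (intro image_eqI[of _ _ "sym_diff a b"]) auto
  qed
  have "card C \<le> 2 * card V"
    unfolding V_def
  proof (rule card_le_mult_card_image[OF finC])
    fix x assume x: "x \<in> C"
    \<comment> \<open>Words that agree outside \<open>D\<close> differ by a word inside
      \<open>D\<close>, hence by \<open>{}\<close> or \<open>D\<close>.\<close>
    have "{y \<in> C. y - D = x - D} \<subseteq> {x, sym_diff x D}"
    proof
      fix y assume y: "y \<in> {y \<in> C. y - D = x - D}"
      then have "sym_diff x y \<subseteq> D" by auto
      then have "sym_diff x y = {} \<or> sym_diff x y = D"
        using intersecting_subset[OF lin inter _ D] linear_familyD(2)[OF lin x] y by auto
      then show "y \<in> {x, sym_diff x D}" by (metis insertCI sym_diff_cancel Un_empty_right Diff_empty empty_Diff)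
    qed
    then have "card {y \<in> C. y - D = x - D} \<le> card {x, sym_diff x D}" by (intro card_mono) auto
    also have "\<dots> \<le> 2" by (simp add: card_insert_le_m1)
    finally show "card {y \<in> C. y - D = x - D} \<le> 2" .
  qed
  then have cardV: "2 ^ m \<le> card V" using card by simp
  have "V \<subseteq> Pow U" using C by (auto simp: V_def)
  then obtain S v where S: "card V \<le> 2 ^ card S" "v \<in> V" "S \<subseteq> v" "S \<subseteq> U"
    by (rule linear_family_information_set[OF U(1) _ linV])
  have "(2::nat) ^ m \<le> 2 ^ card S" using S(1) cardV by linarith
  then have "m \<le> card S" by (simp add: power_increasing_iff)
  obtain c where c: "c \<in> C" "v = c - D" using S(2) by (auto simp: V_def)
  have fc: "finite c" "finite D" using finw c(1) D by auto
  have m: "m \<le> card (c - D)"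
    using \<open>m \<le> card S\<close> S(3) c(2) fc by (meson card_mono finite_Diff le_trans)
  have cd: "sym_diff c D \<in> C" using linear_familyD(2)[OF lin c(1) D] .
  have split: "card c = card (c - D) + card (D \<inter> c)" "card D = card (D - c) + card (D \<inter> c)"
    using card_Int_Diff[OF fc(1), of D] card_Int_Diff[OF fc(2), of c] by (simp_all add: Int_commute)
  have split3: "card (sym_diff c D) = card (c - D) + card (D - c)"
    using fc by (intro card_Un_disjoint) auto
  \<comment> \<open>Maximality against \<open>sym_diff c D\<close> gives the first inequality,
    against \<open>c\<close> the second.\<close>
  have ge: "card (c - D) \<le> card (D \<inter> c)" "card (c - D) \<le> card (D - c)"
    using max[OF c(1)] max[OF cd] split split3 by linarith+
  have subU: "c \<subseteq> U" "D \<subseteq> U" using C c(1) D by auto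
  have cU: "card U = card (U - D) + card (D \<inter> c) + card (D - c)"
  proof -
    have "card U = card (U - D) + card D"
      using U subU fc by (metis add.commute card_Diff_subset card_mono le_add_diff_inverse)
    then show ?thesis using split by simp
  qed
  have le: "card (c - D) \<le> card (U - D)" using subU U by (intro card_mono) auto
  \<comment> \<open>\<open>U\<close> is the union of three disjoint parts of size at least
    \<open>m\<close>, while \<open>card U \<le> 3 * m\<close>.\<close>
  have eq: "card (c - D) = m" "card (U - D) = m" "card (D \<inter> c) = m" "card (D - c) = m"
    using m ge cU le U(2) by linarith+
  have cUD: "c - D = U - D" using subU U eq by (intro card_subset_eq) auto
  have "three_blocks C (U - D) (D \<inter> c) (D - c) m"
  proof
    show "finite (U - D)" "finite (D \<inter> c)" "finite (D - c)" using U fc by auto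
    show "card (U - D) = m" "card (D \<inter> c) = m" "card (D - c) = m" using eq by auto
    show "(U - D) \<inter> (D \<inter> c) = {}" "(D \<inter> c) \<inter> (D - c) = {}" "(U - D) \<inter> (D - c) = {}" by auto
    show "C \<subseteq> Pow ((U - D) \<union> (D \<inter> c) \<union> (D - c))" using C by blast
    show "(D \<inter> c) \<union> (D - c) \<in> C" using D by (simp add: Int_Diff_Un)
    have "(U - D) \<union> (D - c) = sym_diff c D" using cUD by auto
    then show "(U - D) \<union> (D - c) \<in> C" using cd by simp
    have "(U - D) \<union> (D \<inter> c) = c" using cUD by auto
    then show "(U - D) \<union> (D \<inter> c) \<in> C" using c by simp
    show "card d \<le> 2 * m" if "d \<in> C" for d using max[OF that] split eq by simp
  qed (use lin inter card in auto)
  then show thesis using that by blast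
qed

section \<open>Moments of block deviations\<close>

definition chi :: "'a \<Rightarrow> 'a set \<Rightarrow> int" where
  "chi i c = (if i \<in> c then - 1 else 1)"

text \<open>For finite \<open>X\<close> this is the sum of the signs \<open>chi i c\<close> over
  \<open>X\<close>, so its moments reduce to character sums.\<close>

definition dev :: "'a set \<Rightarrow> 'a set \<Rightarrow> int" where
  "dev X c = int (card X) - 2 * int (card (c \<inter> X))"

lemma dev_eq_sum_chi:
  assumes "finite X"
  shows "dev X c = (\<Sum>i\<in>X. chi i c)"
proof -
  have "(\<Sum>i\<in>X. chi i c) = (\<Sum>i\<in>X. 1 - 2 * of_bool (i \<in> c))"
    by (intro sum.cong) (auto simp: chi_def)
  also have "\<dots> = int (card X) - 2 * int (card (X \<inter> c))"
    using assms by (simp add: sum_subtractf flip: sum_distrib_left)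
  finally show ?thesis by (simp add: dev_def Int_commute)
qed

lemma chi_sym_diff: "chi i (sym_diff c d) = chi i c * chi i d"
  by (auto simp: chi_def)

lemma chi_cases: "chi i c = 1 \<or> chi i c = - 1"
  by (simp add: chi_def)

text \<open>Translation by some \<open>d\<close> with \<open>h d = - 1\<close> permutes
  \<open>V\<close> and negates the sum.\<close>

lemma character_sum:
  fixes h :: "'a set \<Rightarrow> int"
  assumes fin: "finite V" and lin: "linear_family V"
    and mult: "\<And>c d. c \<in> V \<Longrightarrow> d \<in> V \<Longrightarrow> h (sym_diff c d) = h c * h d"
    and pm: "\<And>c. c \<in> V \<Longrightarrow> h c = 1 \<or> h c = - 1"
  shows "sum h V = (if \<forall>c\<in>V. h c = 1 then int (card V) else 0)"
proof (cases "\<forall>c\<in>V. h c = 1")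
  case False
  then obtain d where d: "d \<in> V" "h d = - 1" using pm by blast
  have "sum h V = sum (\<lambda>c. h (sym_diff d c)) V"
    using d linear_familyD[OF lin]
    by (intro sum.reindex_bij_witness[where i = "sym_diff d" and j = "sym_diff d"])
      (auto simp: sym_diff_cancel)
  also have "\<dots> = - sum h V" using mult d by (simp add: sum_negf)
  finally have "sum h V = 0" by simp
  then show ?thesis by (simp only: if_not_P[OF False])
qed simp

lemma sum_dev:
  assumes "finite V" "linear_family V" "finite X" "\<And>i. i \<in> X \<Longrightarrow> \<exists>c\<in>V. i \<in> c"
  shows "(\<Sum>c\<in>V. dev X c) = 0"
proof -
  have "(\<Sum>c\<in>V. dev X c) = (\<Sum>i\<in>X. \<Sum>c\<in>V. chi i c)"
    unfolding dev_eq_sum_chi[OF assms(3)] by (rule sum.swap)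
  also have "\<dots> = 0"
  proof (rule sum.neutral, rule ballI)
    fix i assume "i \<in> X"
    then obtain c where "c \<in> V" "i \<in> c" using assms(4) by blast
    then have "c \<in> V" "chi i c \<noteq> 1" by (simp_all add: chi_def)
    then show "(\<Sum>c\<in>V. chi i c) = 0"
      using character_sum[OF assms(1,2), of "chi i"] chi_sym_diff chi_cases by (metis (full_types))
  qed
  finally show ?thesis .
qed

text \<open>In the expanded square, two separated points give a nontrivial character with sum 0;
  each diagonal term gives \<open>card V\<close>.\<close>

lemma sum_dev_square:
  assumes "finite V" "linear_family V" "finite X"
    "\<And>i j. i \<in> X \<Longrightarrow> j \<in> X \<Longrightarrow> i \<noteq> j \<Longrightarrow> \<exists>c\<in>V. i \<in> c \<and> j \<notin> c"
  shows "(\<Sum>c\<in>V. (dev X c)\<^sup>2) = int (card X) * int (card V)"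
proof -
  have "(\<Sum>c\<in>V. (dev X c)\<^sup>2) = (\<Sum>c\<in>V. \<Sum>i\<in>X. \<Sum>j\<in>X. chi i c * chi j c)"
    unfolding dev_eq_sum_chi[OF assms(3)] by (simp add: power2_eq_square sum_product)
  also have "\<dots> = (\<Sum>i\<in>X. \<Sum>j\<in>X. \<Sum>c\<in>V. chi i c * chi j c)"
    by (subst sum.swap, rule sum.cong[OF refl], rule sum.swap)
  also have "\<dots> = (\<Sum>i\<in>X. \<Sum>j\<in>X. if i = j then int (card V) else 0)"
  proof (intro sum.cong refl)
    fix i j assume ij: "i \<in> X" "j \<in> X"
    have s: "(\<Sum>c\<in>V. chi i c * chi j c) =
        (if \<forall>c\<in>V. chi i c * chi j c = 1 then int (card V) else 0)"
      by (intro character_sum assms(1,2)) (auto simp: chi_def)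
    show "(\<Sum>c\<in>V. chi i c * chi j c) = (if i = j then int (card V) else 0)"
    proof (cases "i = j")
      case False
      then obtain c where "c \<in> V" "i \<in> c" "j \<notin> c" using assms(4) ij by blast
      then have "\<not> (\<forall>c\<in>V. chi i c * chi j c = 1)" by (force simp: chi_def)
      then have "(\<Sum>c\<in>V. chi i c * chi j c) = 0" by (simp only: s if_False)
      then show ?thesis using False by simp
    next
      case True
      then have "\<forall>c\<in>V. chi i c * chi j c = 1" by (simp add: chi_def)
      then show ?thesis using s True by simp
    qed
  qed
  also have "\<dots> = int (card X) * int (card V)" using assms(3) by simp
  finally show ?thesis .
qed

text \<open>Each triple of points contributes 0 or \<open>card V\<close>, and \<open>t\<close>
  counts the latter. Both the sign and the divisibility of the sum are used later.\<close>

lemma sum_dev_triple: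
  assumes "finite V" "linear_family V" "finite X" "finite Y" "finite Z"
  obtains t :: nat where "(\<Sum>c\<in>V. dev X c * dev Y c * dev Z c) = int t * int (card V)"
proof -
  define N where "N i j l = (if \<forall>c\<in>V. chi i c * chi j c * chi l c = 1 then 1 else 0 :: nat)" for i j l
  have "(\<Sum>c\<in>V. dev X c * dev Y c * dev Z c) =
      (\<Sum>c\<in>V. \<Sum>i\<in>X. \<Sum>j\<in>Y. \<Sum>l\<in>Z. chi i c * chi j c * chi l c)"
    unfolding dev_eq_sum_chi[OF assms(3)] dev_eq_sum_chi[OF assms(4)] dev_eq_sum_chi[OF assms(5)]
    by (subst sum_product, simp only: sum_distrib_right, simp only: sum_distrib_left)
  also have "\<dots> = (\<Sum>i\<in>X. \<Sum>j\<in>Y. \<Sum>l\<in>Z. \<Sum>c\<in>V. chi i c * chi j c * chi l c)"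
    by (subst sum.swap, rule sum.cong[OF refl], subst sum.swap, rule sum.cong[OF refl], rule sum.swap)
  also have "\<dots> = (\<Sum>i\<in>X. \<Sum>j\<in>Y. \<Sum>l\<in>Z. int (N i j l) * int (card V))"
  proof (intro sum.cong refl)
    fix i j l
    have "(\<Sum>c\<in>V. chi i c * chi j c * chi l c) =
        (if \<forall>c\<in>V. chi i c * chi j c * chi l c = 1 then int (card V) else 0)"
      by (intro character_sum assms(1,2)) (auto simp: chi_def)
    then show "(\<Sum>c\<in>V. chi i c * chi j c * chi l c) = int (N i j l) * int (card V)"
      by (simp add: N_def)
  qed
  also have "\<dots> = int (\<Sum>i\<in>X. \<Sum>j\<in>Y. \<Sum>l\<in>Z. N i j l) * int (card V)"
    by (simp add: sum_distrib_right)
  finally show thesis by (rule that)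
qed

section \<open>The extremal configuration\<close>

context three_blocks
begin

text \<open>Interpreting the locale at the shifted blocks transfers every fact about
  \<open>X\<close> to \<open>Y\<close> and \<open>Z\<close>.\<close>

lemma rotate: "three_blocks C Y Z X m"
  using fin card_blocks disj sub lin inter pairs card_ge weight_le
  by unfold_locales (auto simp: Un_ac Int_ac)

lemma finite_C: "finite C"
  using sub fin by (meson finite_Pow_iff finite_UnI finite_subset)

lemma finite_word: "c \<in> C \<Longrightarrow> finite c"
  using sub fin by (meson PowD finite_UnI finite_subset subsetD)

lemma weight_ge:
  assumes "c \<in> C" "c \<noteq> {}"
  shows "m + 1 \<le> card c"
  using intersecting_card_ge[OF _ sub lin inter assms card_ge] fin by simp

lemma weight_eq:
  assumes "c \<in> C"
  shows "card c = card (c \<inter> X) + card (c \<inter> Y) + card (c \<inter> Z)"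
proof -
  have "c = (c \<inter> X) \<union> (c \<inter> Y) \<union> (c \<inter> Z)" using assms sub by auto
  then have "card c = card ((c \<inter> X) \<union> (c \<inter> Y) \<union> (c \<inter> Z))" by simp
  also have "\<dots> = card ((c \<inter> X) \<union> (c \<inter> Y)) + card (c \<inter> Z)"
    using fin disj by (intro card_Un_disjoint) auto
  also have "card ((c \<inter> X) \<union> (c \<inter> Y)) = card (c \<inter> X) + card (c \<inter> Y)"
    using fin disj by (intro card_Un_disjoint) auto
  finally show ?thesis .
qed

lemma trace_empty:
  assumes "c \<in> C" "c \<inter> X = {}"
  shows "c = {} \<or> c = Y \<union> Z"
  using assms sub by (intro intersecting_subset[OF lin inter _ pairs(1)]) auto

lemma card_C_le: "card C \<le> 2 * card ((\<lambda>c. c \<inter> X) ` C)"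
proof (rule card_le_mult_card_image[OF finite_C])
  fix c assume c: "c \<in> C"
  have "{d \<in> C. d \<inter> X = c \<inter> X} \<subseteq> {c, sym_diff c (Y \<union> Z)}"
  proof
    fix d assume d: "d \<in> {d \<in> C. d \<inter> X = c \<inter> X}"
    then have "sym_diff c d \<inter> X = {}" by auto
    then have "sym_diff c d = {} \<or> sym_diff c d = Y \<union> Z"
      using d by (intro trace_empty linear_familyD(2)[OF lin c]) auto
    then show "d \<in> {c, sym_diff c (Y \<union> Z)}" by (metis insertCI sym_diff_cancel Un_empty_right Diff_empty empty_Diff)
  qed
  then have "card {d \<in> C. d \<inter> X = c \<inter> X} \<le> card {c, sym_diff c (Y \<union> Z)}" by (intro card_mono) auto
  also have "\<dots> \<le> 2" by (simp add: card_insert_le_m1)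
  finally show "card {d \<in> C. d \<inter> X = c \<inter> X} \<le> 2" .
qed

text \<open>At least \<open>2 ^ (m + 1)\<close> words and at most two words per trace force
  \<open>2 ^ m\<close> traces, which are all subsets of \<open>X\<close>.\<close>

lemma trace_image: "(\<lambda>c. c \<inter> X) ` C = Pow X"
proof (rule card_seteq)
  show "card (Pow X) \<le> card ((\<lambda>c. c \<inter> X) ` C)"
    using card_C_le card_ge fin card_blocks by (simp add: card_Pow)
qed (use fin in auto)

lemma trace_full:
  assumes "A \<subseteq> X"
  obtains c where "c \<in> C" "c \<inter> X = A"
  using trace_image assms by (metis (no_types, lifting) PowI imageE)

lemma card_C: "card C = 2 ^ (m + 1)"
  using card_C_le card_ge trace_image fin card_blocks by (simp add: card_Pow)

text \<open>The subcode spanned by the pairs. Exactly for its members some sum with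
  \<open>{}\<close> or a pair is the zero word, which escapes the lower weight bound.\<close>

definition plane :: "'a set set" where
  "plane = {{}, Y \<union> Z, X \<union> Z, X \<union> Y}"

lemma card_block_le: "card (c \<inter> X) \<le> m"
  using card_mono[of X "c \<inter> X"] fin card_blocks by simp

lemma weight_sym_diff_pair:
  assumes "c \<in> C"
  shows "card (sym_diff c (Y \<union> Z)) + card (c \<inter> Y) + card (c \<inter> Z) = card (c \<inter> X) + 2 * m"
proof -
  let ?d = "sym_diff c (Y \<union> Z)"
  have "?d \<inter> X = c \<inter> X" "?d \<inter> Y = Y - c" "?d \<inter> Z = Z - c" using disj by auto
  moreover have "?d \<in> C" using linear_familyD(2)[OF lin assms pairs(1)] .
  ultimately have "card ?d = card (c \<inter> X) + card (Y - c) + card (Z - c)"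
    using weight_eq by metis
  moreover have "card (Y - c) + card (c \<inter> Y) = m" "card (Z - c) + card (c \<inter> Z) = m"
    using card_Int_Diff[OF fin(2), of c] card_Int_Diff[OF fin(3), of c] card_blocks
    by (simp_all add: Int_commute)
  ultimately show ?thesis by simp
qed

text \<open>Both \<open>c\<close> and \<open>sym_diff c (Y \<union> Z)\<close> are nonzero words, so
  both weights lie between \<open>m + 1\<close> and \<open>2 * m\<close>.\<close>

lemma block_bounds_aux:
  assumes "c \<in> C" "c \<notin> plane"
  shows "m + 1 \<le> card (c \<inter> X) + card (c \<inter> Y) + card (c \<inter> Z)"
    "card (c \<inter> X) + card (c \<inter> Y) + card (c \<inter> Z) \<le> 2 * m"
    "card (c \<inter> X) \<le> card (c \<inter> Y) + card (c \<inter> Z)"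
    "card (c \<inter> Y) + card (c \<inter> Z) + 1 \<le> card (c \<inter> X) + m"
proof -
  have "sym_diff c (Y \<union> Z) \<noteq> {}" using assms(2) by (auto simp: plane_def)
  moreover have "sym_diff c (Y \<union> Z) \<in> C" using linear_familyD(2)[OF lin assms(1) pairs(1)] .
  ultimately have "m + 1 \<le> card (sym_diff c (Y \<union> Z))" "card (sym_diff c (Y \<union> Z)) \<le> 2 * m"
    using weight_ge weight_le by blast+
  then show "card (c \<inter> X) \<le> card (c \<inter> Y) + card (c \<inter> Z)"
    "card (c \<inter> Y) + card (c \<inter> Z) + 1 \<le> card (c \<inter> X) + m"
    using weight_sym_diff_pair[OF assms(1)] by linarith+
  have "c \<noteq> {}" using assms(2) by (auto simp: plane_def)
  then show "m + 1 \<le> card (c \<inter> X) + card (c \<inter> Y) + card (c \<inter> Z)"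
    "card (c \<inter> X) + card (c \<inter> Y) + card (c \<inter> Z) \<le> 2 * m"
    using weight_ge[OF assms(1)] weight_le[OF assms(1)] weight_eq[OF assms(1)] by simp_all
qed

end

section \<open>Rows: words with a single point in \<open>X\<close>\<close>

context three_blocks
begin

interpretation YZX: three_blocks C Y Z X m by (rule rotate)
interpretation ZXY: three_blocks C Z X Y m by (rule YZX.rotate)

lemma plane_rotate: "YZX.plane = plane" "ZXY.plane = plane"
  by (auto simp: plane_def YZX.plane_def ZXY.plane_def)

lemmas block_bounds = block_bounds_aux
  YZX.block_bounds_aux(3,4)[unfolded plane_rotate] ZXY.block_bounds_aux(3,4)[unfolded plane_rotate]

text \<open>With one point in \<open>X\<close>, the lower bound on the weight of \<open>r\<close>
  and that on the weight of \<open>sym_diff r (Y \<union> Z)\<close> squeeze the rest to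
  \<open>m\<close>; the rotated bounds balance \<open>Y\<close> against \<open>Z\<close>.\<close>

lemma row_weights:
  assumes "2 \<le> m" "r \<in> C" "r \<inter> X = {i}"
  shows "card (r \<inter> Y) + card (r \<inter> Z) = m" "card (r \<inter> Y) \<le> card (r \<inter> Z) + 1"
    "card (r \<inter> Z) \<le> card (r \<inter> Y) + 1" "card r = m + 1"
proof -
  have "card (r \<inter> X) = 1" using assms(3) by simp
  \<comment> \<open>Members of \<open>plane\<close> meet \<open>X\<close> in 0 or \<open>m\<close>
    points, and \<open>m\<close> is at least 2.\<close>
  moreover have "card (d \<inter> X) \<noteq> 1" if "d \<in> plane" for d
  proof -
    have "(Y \<union> Z) \<inter> X = {}" "(X \<union> Z) \<inter> X = X" "(X \<union> Y) \<inter> X = X" using disj by auto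
    then show ?thesis using that card_blocks assms(1) by (auto simp: plane_def)
  qed
  ultimately have "r \<notin> plane" by blast
  then have "card (r \<inter> Y) + card (r \<inter> Z) = m \<and> card (r \<inter> Y) \<le> card (r \<inter> Z) + 1 \<and>
      card (r \<inter> Z) \<le> card (r \<inter> Y) + 1"
    using block_bounds[OF assms(2)] \<open>card (r \<inter> X) = 1\<close> by auto
  then show "card (r \<inter> Y) + card (r \<inter> Z) = m" "card (r \<inter> Y) \<le> card (r \<inter> Z) + 1"
    "card (r \<inter> Z) \<le> card (r \<inter> Y) + 1" "card r = m + 1"
    using weight_eq[OF assms(2)] \<open>card (r \<inter> X) = 1\<close> by simp_all
qed

text \<open>Adding the row at a point of the trace removes that point, until the trace is empty and
  \<open>{}\<close> or \<open>Y \<union> Z\<close> remains. Invariants can thus be computed row by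
  row.\<close>

lemma trace_induct [consumes 1, case_names empty pair step]:
  assumes "c \<in> C" and "P {}" "P (Y \<union> Z)"
    and step: "\<And>d r i. d \<in> C \<Longrightarrow> r \<in> C \<Longrightarrow> i \<in> X \<Longrightarrow> i \<notin> d \<Longrightarrow> r \<inter> X = {i} \<Longrightarrow> P d \<Longrightarrow> P (sym_diff d r)"
  shows "P c"
  using assms(1)
proof (induction "card (c \<inter> X)" arbitrary: c)
  case 0
  then have "c \<inter> X = {}" using fin by simp
  then show ?case using trace_empty[OF 0(2)] assms by auto
next
  case (Suc n)
  then have "c \<inter> X \<noteq> {}" by auto
  then obtain i where i: "i \<in> c" "i \<in> X" by blast
  obtain r where r: "r \<in> C" "r \<inter> X = {i}" using trace_full[of "{i}"] i by auto
  let ?d = "sym_diff c r"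
  have d: "?d \<in> C" using linear_familyD(2)[OF lin Suc.prems r(1)] .
  have "?d \<inter> X = (c \<inter> X) - {i}" using r i by auto
  then have "card (?d \<inter> X) = n" using Suc.hyps(2) i fin by simp
  then have "P ?d" using Suc.hyps(1) d by simp
  moreover have "i \<notin> ?d" using r i by auto
  ultimately have "P (sym_diff ?d r)" using step d r i by blast
  moreover have "sym_diff ?d r = c" by auto
  ultimately show ?case by simp
qed

lemma card_trace_step:
  assumes "d \<in> C" "i \<in> X" "i \<notin> d" "r \<inter> X = {i}"
  shows "card (sym_diff d r \<inter> X) = card (d \<inter> X) + 1"
proof -
  have "sym_diff d r \<inter> X = insert i (d \<inter> X)" using assms by auto
  then show ?thesis using assms fin by simp
qed

lemma card_pair: "card (Y \<union> Z) = 2 * m"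
  using fin disj card_blocks by (simp add: card_Un_disjoint)

text \<open>Each row contributes weight \<open>m + 1\<close>, and \<open>Y \<union> Z\<close> has
  even weight.\<close>

lemma weight_parity:
  assumes m: "2 \<le> m" and "c \<in> C"
  shows "even (card c) \<longleftrightarrow> even (card (c \<inter> X) * (m + 1))"
  using assms(2)
proof (induction c rule: trace_induct)
  case empty
  then show ?case by simp
next
  case pair
  have "(Y \<union> Z) \<inter> X = {}" using disj by auto
  then show ?case using card_pair by simp
next
  case (step d r i)
  have "card r = m + 1" using row_weights[OF m] step by blast
  then have "even (card (sym_diff d r)) \<longleftrightarrow> (even (card d) \<longleftrightarrow> even (m + 1))"
    using even_card_sym_diff finite_word step by metis
  moreover have "card (sym_diff d r \<inter> X) = card (d \<inter> X) + 1" using card_trace_step step by blast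
  ultimately show ?case using step by (simp del: Un_iff) blast
qed

end

section \<open>Block parities for even \<open>m\<close>\<close>

context three_blocks
begin

interpretation YZX: three_blocks C Y Z X m by (rule rotate)
interpretation ZXY: three_blocks C Z X Y m by (rule YZX.rotate)

text \<open>As \<open>m + 1\<close> is odd, \<open>weight_parity\<close> and its rotations equate
  every block parity with the parity of the whole word.\<close>

lemma block_parity:
  assumes "2 \<le> m" "even m" "c \<in> C"
  shows "even (card (c \<inter> Y)) \<longleftrightarrow> even (card (c \<inter> X))" "even (card (c \<inter> Z)) \<longleftrightarrow> even (card (c \<inter> X))"
    "even (card c) \<longleftrightarrow> even (card (c \<inter> X))"
  using weight_parity YZX.weight_parity ZXY.weight_parity assms by auto

lemma even_dim_mod_4:
  assumes "2 \<le> m" "even m"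
  shows "m mod 4 = 2"
proof -
  obtain i where "i \<in> X" using card_blocks assms by fastforce
  then obtain r where r: "r \<in> C" "r \<inter> X = {i}" using trace_full[of "{i}"] by auto
  have "odd (card (r \<inter> Y))" "odd (card (r \<inter> Z))" using block_parity[OF assms r(1)] r(2) by simp_all
  then show ?thesis using row_weights[OF assms(1) r] by presburger
qed

end

section \<open>Weights modulo 4 and second moments\<close>

context three_blocks
begin

interpretation YZX: three_blocks C Y Z X m by (rule rotate)
interpretation ZXY: three_blocks C Z X Y m by (rule YZX.rotate)

lemma row_exists:
  assumes "i \<in> X"
  obtains r where "r \<in> C" "r \<inter> X = {i}"
  using trace_full[of "{i}"] assms by auto

text \<open>The sum of two rows has within 1 of \<open>m\<close> points in \<open>Y\<close> and
  \<open>Z\<close> together, and parity makes it \<open>m\<close>. Comparing weights, the rows share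
  \<open>m / 2\<close> points, an odd number.\<close>

lemma rows_meet_oddly:
  assumes m: "2 < m" "even m"
    and r: "r \<in> C" "r \<inter> X = {i}" and s: "s \<in> C" "s \<inter> X = {j}" and "i \<noteq> j"
  shows "odd (card (r \<inter> s))"
proof -
  let ?d = "sym_diff r s"
  have d: "?d \<in> C" using linear_familyD(2)[OF lin r(1) s(1)] .
  have "?d \<inter> X = {i, j}" using r s \<open>i \<noteq> j\<close> by auto
  then have two: "card (?d \<inter> X) = 2" using \<open>i \<noteq> j\<close> by simp
  moreover have "card (e \<inter> X) \<noteq> 2" if "e \<in> plane" for e
  proof -
    have "(Y \<union> Z) \<inter> X = {}" "(X \<union> Z) \<inter> X = X" "(X \<union> Y) \<inter> X = X" using disj by auto
    then show ?thesis using that card_blocks m by (auto simp: plane_def)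
  qed
  ultimately have "?d \<notin> plane" by blast
  from block_bounds[OF d this] have
    "m \<le> card (?d \<inter> Y) + card (?d \<inter> Z) + 1" "card (?d \<inter> Y) + card (?d \<inter> Z) \<le> m + 1"
    unfolding two by linarith+
  moreover have "even (card (?d \<inter> Y) + card (?d \<inter> Z))"
    using block_parity[OF _ m(2) d] m two by (simp del: Un_iff)
  ultimately have "card (?d \<inter> Y) + card (?d \<inter> Z) = m" using m(2) by presburger
  then have "card ?d = m + 2" using weight_eq[OF d] two by simp
  moreover have "card r = m + 1" "card s = m + 1" using row_weights(4) r s m by simp_all
  ultimately have "2 * card (r \<inter> s) = m"
    using card_sym_diff_int[OF finite_word[OF r(1)] finite_word[OF s(1)]] by linarith
  moreover have "m mod 4 = 2" using even_dim_mod_4 m by simp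
  ultimately show ?thesis by presburger
qed

text \<open>As \<open>i \<notin> d\<close>, the word \<open>d\<close> is a sum of rows at other
  points, each meeting \<open>r\<close> oddly, and possibly of \<open>Y \<union> Z\<close>, which
  meets \<open>r\<close> in \<open>m\<close> points.\<close>

lemma row_meet_parity:
  assumes m: "2 < m" "even m" and r: "r \<in> C" "r \<inter> X = {i}" and "d \<in> C" "i \<notin> d"
  shows "even (card (d \<inter> r)) \<longleftrightarrow> even (card (d \<inter> X))"
  using assms(5,6)
proof (induction d rule: trace_induct)
  case pair
  have "(Y \<union> Z) \<inter> r = (r \<inter> Y) \<union> (r \<inter> Z)" by auto
  moreover have "card ((r \<inter> Y) \<union> (r \<inter> Z)) = card (r \<inter> Y) + card (r \<inter> Z)"
    using fin disj by (intro card_Un_disjoint) auto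
  ultimately have "card ((Y \<union> Z) \<inter> r) = m" using row_weights(1)[OF _ r] m by simp
  moreover have "(Y \<union> Z) \<inter> X = {}" using disj by auto
  ultimately show ?case using m by simp
next
  case (step d s j)
  have "i \<noteq> j" using step by auto
  then have "i \<notin> d" using step r by auto
  have "even (card (sym_diff d s \<inter> r)) \<longleftrightarrow> (even (card (d \<inter> r)) \<longleftrightarrow> even (card (s \<inter> r)))"
    unfolding sym_diff_Int using step finite_word by (intro even_card_sym_diff) auto
  moreover have "odd (card (s \<inter> r))" using rows_meet_oddly[OF m] step r \<open>i \<noteq> j\<close> by metis
  moreover have "card (sym_diff d s \<inter> X) = card (d \<inter> X) + 1" using card_trace_step step by blast
  ultimately show ?case using step \<open>i \<notin> d\<close> by (simp del: Un_iff)
qed simp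

text \<open>Adding a row \<open>r\<close> changes the weight by
  \<open>m + 1 - 2 * card (d \<inter> r)\<close>. Here \<open>m + 1\<close> is 3 modulo 4 and the
  intersection has the parity of the trace, so the residue alternates between 0 and 3.\<close>

lemma weight_mod_4:
  assumes m: "2 < m" "even m" and "c \<in> C"
  shows "card c mod 4 = (if even (card (c \<inter> X)) then 0 else 3)"
  using assms(3)
proof (induction c rule: trace_induct)
  case pair
  have "(Y \<union> Z) \<inter> X = {}" using disj by auto
  moreover have "(2 * m) mod 4 = 0" using m by presburger
  ultimately show ?case using card_pair by simp
next
  case (step d r i)
  have "card r = m + 1" using row_weights[OF _ step(2,5)] m by simp
  moreover have "m mod 4 = 2" using even_dim_mod_4 m by simp
  moreover have "even (card (d \<inter> r)) \<longleftrightarrow> even (card (d \<inter> X))"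
    using row_meet_parity[OF m] step by blast
  moreover have "card (sym_diff d r \<inter> X) = card (d \<inter> X) + 1" using card_trace_step step by blast
  moreover have "card (sym_diff d r) + 2 * card (d \<inter> r) = card d + card r"
    using card_sym_diff_int[OF finite_word finite_word, OF step(1,2)] by linarith
  moreover note \<open>card d mod 4 = _\<close>
  ultimately show ?case by (cases "even (card (d \<inter> X))"; simp del: Un_iff; presburger)
qed simp

text \<open>For even \<open>m\<close>, \<open>block_parity\<close> makes this the set of words with
  all block weights even.\<close>

definition even_words :: "'a set set" where
  "even_words = {c \<in> C. even (card (c \<inter> X))}"

lemma even_card_Int_sym_diff:
  assumes "c \<in> C" "d \<in> C"
  shows "even (card (sym_diff c d \<inter> S)) \<longleftrightarrow> (even (card (c \<inter> S)) \<longleftrightarrow> even (card (d \<inter> S)))"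
  unfolding sym_diff_Int using assms finite_word by (intro even_card_sym_diff) auto

lemma linear_even_words: "linear_family even_words"
  using lin even_card_Int_sym_diff unfolding linear_family_def even_words_def by auto

lemma finite_even_words: "finite even_words"
  using finite_C by (simp add: even_words_def)

lemma card_even_words:
  assumes "0 < m"
  shows "card C = 2 * card even_words" "card even_words = 2 ^ m"
proof -
  obtain i where "i \<in> X" using card_blocks assms by fastforce
  then obtain r where r: "r \<in> C" "r \<inter> X = {i}" by (rule row_exists)
  then have "odd (card (r \<inter> X))" by simp
  then show "card C = 2 * card even_words"
    unfolding even_words_def
    using even_card_Int_sym_diff r(1)
    by (intro linear_family_half[OF finite_C lin]) auto
  then show "card even_words = 2 ^ m" using card_C by simp
qed

lemma even_words_separate:
  assumes "3 \<le> m" "i \<in> X" "j \<in> X" "i \<noteq> j"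
  shows "\<exists>c\<in>even_words. i \<in> c \<and> j \<notin> c"
proof -
  have "card {i, j} < card X" using assms card_blocks by simp
  then obtain l where l: "l \<in> X" "l \<noteq> i" "l \<noteq> j"
    by (metis card_mono finite.emptyI finite.insertI insert_iff not_less subsetI)
  then obtain c where "c \<in> C" "c \<inter> X = {i, l}" using trace_full[of "{i, l}"] assms by auto
  then show ?thesis using l assms by (intro bexI[of _ c]) (auto simp: even_words_def)
qed

lemma sum_dev_square_even_words:
  assumes "3 \<le> m"
  shows "(\<Sum>c\<in>even_words. (dev X c)\<^sup>2) = int m * 2 ^ m"
  using sum_dev_square[OF finite_even_words linear_even_words fin(1)] even_words_separate
    card_blocks card_even_words assms by simp

lemma sum_dev_square_C:
  assumes "3 \<le> m"
  shows "(\<Sum>c\<in>C. (dev X c)\<^sup>2) = int m * 2 ^ (m + 1)"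
proof -
  have "\<exists>c\<in>C. i \<in> c \<and> j \<notin> c" if "i \<in> X" "j \<in> X" "i \<noteq> j" for i j
    using even_words_separate[OF assms that] by (auto simp: even_words_def)
  then show ?thesis
    using sum_dev_square[OF finite_C lin fin(1)] card_blocks card_C by simp
qed

end

section \<open>Exclusion of \<open>m = 6\<close> and \<open>m = 10\<close>\<close>

context three_blocks
begin

interpretation YZX: three_blocks C Y Z X m by (rule rotate)
interpretation ZXY: three_blocks C Z X Y m by (rule YZX.rotate)

lemma even_words_rotate:
  assumes "2 \<le> m" "even m"
  shows "YZX.even_words = even_words" "ZXY.even_words = even_words"
  using block_parity[OF assms] by (auto simp: even_words_def YZX.even_words_def ZXY.even_words_def)

lemma sum_dev_squares_even_words:
  assumes "3 \<le> m" "even m"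
  shows "(\<Sum>c\<in>even_words. (dev X c)\<^sup>2 + (dev Y c)\<^sup>2 + (dev Z c)\<^sup>2) = 3 * int m * 2 ^ m"
  using sum_dev_square_even_words YZX.sum_dev_square_even_words ZXY.sum_dev_square_even_words
    even_words_rotate assms by (simp add: sum.distrib)

lemma sum_dev_squares_C:
  assumes "3 \<le> m"
  shows "(\<Sum>c\<in>C. (dev X c)\<^sup>2 + (dev Y c)\<^sup>2 + (dev Z c)\<^sup>2) = 3 * int m * 2 ^ (m + 1)"
  using sum_dev_square_C YZX.sum_dev_square_C ZXY.sum_dev_square_C assms by (simp add: sum.distrib)

text \<open>The second moments over \<open>C\<close> and \<open>even_words\<close> leave
  \<open>2304 - 1152 = 1152\<close> for the other 64 words, but each of these contributes only
  16.\<close>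

lemma dim_ne_6: "m \<noteq> 6"
proof
  assume m: "m = 6"
  have odd: "(dev X c)\<^sup>2 + (dev Y c)\<^sup>2 + (dev Z c)\<^sup>2 = 16" if c: "c \<in> C" "c \<notin> even_words" for c
  proof -
    have o: "odd (card (c \<inter> X))" using c by (simp add: even_words_def)
    then have p: "odd (card (c \<inter> Y))" "odd (card (c \<inter> Z))" using block_parity[OF _ _ c(1)] m by simp_all
    have w: "(card (c \<inter> X) + card (c \<inter> Y) + card (c \<inter> Z)) mod 4 = 3"
      using weight_mod_4[OF _ _ c(1)] weight_eq[OF c(1)] o m by simp
    have "{} \<in> even_words" "Y \<union> Z \<in> even_words" "X \<union> Z \<in> even_words" "X \<union> Y \<in> even_words"
    proof -
      have "(Y \<union> Z) \<inter> X = {}" "(X \<union> Z) \<inter> X = X" "(X \<union> Y) \<inter> X = X" using disj by auto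
      then show "{} \<in> even_words" "Y \<union> Z \<in> even_words" "X \<union> Z \<in> even_words" "X \<union> Y \<in> even_words"
        using pairs linear_familyD(1)[OF lin] card_blocks m by (simp_all add: even_words_def)
    qed
    then have "c \<notin> plane" using c(2) by (auto simp: plane_def)
    note b = block_bounds[OF c(1) this]
    have "card (c \<inter> X) \<le> 6" "card (c \<inter> Y) \<le> 6" "card (c \<inter> Z) \<le> 6"
      using card_block_le YZX.card_block_le ZXY.card_block_le m by simp_all
    then have "card (c \<inter> X) \<in> {1, 3, 5}" "card (c \<inter> Y) \<in> {1, 3, 5}" "card (c \<inter> Z) \<in> {1, 3, 5}"
      using o p by (simp_all, presburger+)
    \<comment> \<open>The surviving types have one block weight 1 or 5 and two block weights 3: one
      deviation is 4 or -4, the others vanish.\<close>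
    then show ?thesis using b w m card_blocks unfolding dev_def by auto
  qed
  let ?q = "\<lambda>c. (dev X c)\<^sup>2 + (dev Y c)\<^sup>2 + (dev Z c)\<^sup>2"
  have "(\<Sum>c\<in>C - even_words. ?q c) = 16 * int (card (C - even_words))"
    using odd by simp
  moreover have "card (C - even_words) = 64"
    using card_even_words card_C m finite_even_words
    by (subst card_Diff_subset) (auto simp: even_words_def)
  moreover have "(\<Sum>c\<in>C. ?q c) = (\<Sum>c\<in>C - even_words. ?q c) + (\<Sum>c\<in>even_words. ?q c)"
    using finite_C by (intro sum.subset_diff) (auto simp: even_words_def)
  ultimately show False using sum_dev_squares_C sum_dev_squares_even_words m by simp
qed

lemma dim_ne_10: "m \<noteq> 10"
proof
  assume m: "m = 10"
  \<comment> \<open>For even words outside \<open>plane\<close>, the squares sum to 12 with product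
    8, or to 44 with product -24; adding the product makes both cases 20.\<close>
  let ?q = "\<lambda>c. (dev X c)\<^sup>2 + (dev Y c)\<^sup>2 + (dev Z c)\<^sup>2 + dev X c * dev Y c * dev Z c"
  have nz: "?q c = 20" if c: "c \<in> even_words" "c \<notin> plane" for c
  proof -
    have C: "c \<in> C" and e: "even (card (c \<inter> X))" using c by (simp_all add: even_words_def)
    then have p: "even (card (c \<inter> Y))" "even (card (c \<inter> Z))" using block_parity[OF _ _ C] m by simp_all
    have w: "(card (c \<inter> X) + card (c \<inter> Y) + card (c \<inter> Z)) mod 4 = 0"
      using weight_mod_4[OF _ _ C] weight_eq[OF C] e m by simp
    note b = block_bounds[OF C c(2)]
    have "card (c \<inter> X) \<le> 10" "card (c \<inter> Y) \<le> 10" "card (c \<inter> Z) \<le> 10"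
      using card_block_le YZX.card_block_le ZXY.card_block_le m by simp_all
    then have "card (c \<inter> X) \<in> {0, 2, 4, 6, 8, 10}" "card (c \<inter> Y) \<in> {0, 2, 4, 6, 8, 10}"
      "card (c \<inter> Z) \<in> {0, 2, 4, 6, 8, 10}"
      using e p by (simp_all, presburger+)
    then show ?thesis using b w m card_blocks unfolding dev_def by auto
  qed
  have tr: "(Y \<union> Z) \<inter> X = {}" "(X \<union> Z) \<inter> X = X" "(X \<union> Y) \<inter> X = X"
    "(Y \<union> Z) \<inter> Y = Y" "(X \<union> Z) \<inter> Y = {}" "(X \<union> Y) \<inter> Y = Y"
    "(Y \<union> Z) \<inter> Z = Z" "(X \<union> Z) \<inter> Z = Z" "(X \<union> Y) \<inter> Z = {}"
    using disj by auto
  have sub: "plane \<subseteq> even_words"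
    using pairs linear_familyD(1)[OF lin] card_blocks m tr by (auto simp: even_words_def plane_def)
  have "X \<noteq> {}" "Y \<noteq> {}" "Z \<noteq> {}" using card_blocks m by auto
  then have "Y \<union> Z \<noteq> {}" "X \<union> Z \<noteq> {}" "X \<union> Y \<noteq> {}"
    "Y \<union> Z \<noteq> X \<union> Z" "Y \<union> Z \<noteq> X \<union> Y" "X \<union> Z \<noteq> X \<union> Y"
    using tr by (blast, blast, blast, metis+)
  then have "card plane = 4" by (simp add: plane_def del: Un_empty)
  have pl: "?q c = 1300" if "c \<in> plane" for c
    using that card_blocks m tr by (auto simp: plane_def dev_def)
  have "sum ?q even_words = sum ?q (even_words - plane) + sum ?q plane"
    using finite_even_words sub by (intro sum.subset_diff)
  also have "\<dots> = 20 * int (card (even_words - plane)) + 1300 * int (card plane)"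
    using nz pl by simp
  also have "card (even_words - plane) = 1020"
    using card_even_words m sub \<open>card plane = 4\<close> finite_subset[OF sub finite_even_words]
    by (simp add: card_Diff_subset)
  finally have "sum ?q even_words = 25600" using \<open>card plane = 4\<close> by simp
  \<comment> \<open>The mixed third moment is nonnegative, yet the totals make it
    \<open>25600 - 30720\<close>.\<close>
  moreover obtain t where
    "(\<Sum>c\<in>even_words. dev X c * dev Y c * dev Z c) = int t * int (card even_words)"
    using sum_dev_triple[OF finite_even_words linear_even_words fin] .
  then have "(\<Sum>c\<in>even_words. dev X c * dev Y c * dev Z c) \<ge> 0" by simp
  moreover have "(\<Sum>c\<in>even_words. (dev X c)\<^sup>2 + (dev Y c)\<^sup>2 + (dev Z c)\<^sup>2) = 30720"
    using sum_dev_squares_even_words m by simp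
  moreover have "sum ?q even_words = (\<Sum>c\<in>even_words. (dev X c)\<^sup>2 + (dev Y c)\<^sup>2 + (dev Z c)\<^sup>2) +
      (\<Sum>c\<in>even_words. dev X c * dev Y c * dev Z c)"
    by (simp add: sum.distrib)
  ultimately show False by linarith
qed

end

section \<open>Dimension eight\<close>

context three_blocks
begin

text \<open>For \<open>m = 7\<close> all weights are even, so two of these parities imply the third.
  The blocks are then odd, which keeps all of \<open>plane\<close> except \<open>{}\<close>
  out.\<close>

definition block_even :: "'a set set" where
  "block_even = {c \<in> C. even (card (c \<inter> X)) \<and> even (card (c \<inter> Y)) \<and> even (card (c \<inter> Z))}"

end

context three_blocks
begin

interpretation YZX: three_blocks C Y Z X m by (rule rotate)
interpretation ZXY: three_blocks C Z X Y m by (rule YZX.rotate)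

lemma block_even_rotate: "YZX.block_even = block_even" "ZXY.block_even = block_even"
  by (auto simp: block_even_def YZX.block_even_def ZXY.block_even_def)

lemma linear_block_even: "linear_family block_even"
  using lin even_card_Int_sym_diff unfolding linear_family_def block_even_def by auto

lemma finite_block_even: "finite block_even"
  using finite_C by (simp add: block_even_def)

lemma block_even_word: "w \<in> block_even \<Longrightarrow> w \<in> C"
  by (simp add: block_even_def)

lemma even_weight_7:
  assumes "m = 7" "c \<in> C"
  shows "even (card (c \<inter> X) + card (c \<inter> Y) + card (c \<inter> Z))"
  using weight_parity[OF _ assms(2)] weight_eq[OF assms(2)] assms(1) by simp

text \<open>Two independent parities cut 256 words down to 64; \<open>Y \<union> Z\<close> shows
  that the parity on \<open>Y\<close> does not follow from that on \<open>X\<close>.\<close>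

lemma card_block_even:
  assumes m: "m = 7"
  shows "card block_even = 64"
proof -
  have eq: "block_even = {c \<in> even_words. even (card (c \<inter> Y))}"
    unfolding block_even_def even_words_def using even_weight_7[OF m] by fastforce
  have t: "(Y \<union> Z) \<inter> X = {}" "(Y \<union> Z) \<inter> Y = Y" using disj by auto
  then have "Y \<union> Z \<in> even_words" using pairs by (simp add: even_words_def)
  moreover have "odd (card ((Y \<union> Z) \<inter> Y))" using t card_blocks m by simp
  ultimately have "card even_words = 2 * card block_even"
    unfolding eq
    using even_card_Int_sym_diff
    by (intro linear_family_half[OF finite_even_words linear_even_words])
      (auto simp: even_words_def)
  then show ?thesis using card_even_words m by simp
qed

text \<open>Adding \<open>Y \<union> Z\<close> flips the parities on the odd blocks \<open>Y\<close>
  and \<open>Z\<close> and leaves the trace on \<open>X\<close> alone.\<close>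

lemma even_trace:
  assumes m: "m = 7" and A: "A \<subseteq> X" "even (card A)"
  obtains w where "w \<in> block_even" "w \<inter> X = A"
proof -
  obtain c where c: "c \<in> C" "c \<inter> X = A" using trace_full A by blast
  have t: "(Y \<union> Z) \<inter> X = {}" "(Y \<union> Z) \<inter> Y = Y" "(Y \<union> Z) \<inter> Z = Z" using disj by auto
  have par: "even (card (c \<inter> Y)) \<longleftrightarrow> even (card (c \<inter> Z))"
    using even_weight_7[OF m c(1)] A(2) c(2) by simp
  show thesis
  proof (cases "even (card (c \<inter> Y))")
    case True
    then show ?thesis using that[of c] c A par by (simp add: block_even_def)
  next
    case False
    let ?d = "sym_diff c (Y \<union> Z)"
    have "?d \<in> C" using linear_familyD(2)[OF lin c(1) pairs(1)] .
    moreover have "?d \<inter> X = A" using t c by auto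
    moreover have "even (card (?d \<inter> Y))" "even (card (?d \<inter> Z))"
      using even_card_Int_sym_diff[OF c(1) pairs(1)] t False par card_blocks m
      by (simp_all del: Un_iff)
    ultimately show ?thesis using that[of ?d] A by (simp add: block_even_def)
  qed
qed

lemma block_even_trace_empty:
  assumes "m = 7" "w \<in> block_even" "w \<inter> X = {}"
  shows "w = {}"
proof -
  have "(Y \<union> Z) \<inter> Y = Y" using disj by auto
  then have "Y \<union> Z \<notin> block_even" using assms(1) card_blocks by (simp add: block_even_def)
  then show ?thesis using trace_empty[of w] assms by (auto simp: block_even_def)
qed

text \<open>The list is what \<open>block_bounds\<close> leaves of the triples of even numbers up to
  6.\<close>

lemma block_even_types:
  assumes m: "m = 7" and w: "w \<in> block_even" "w \<noteq> {}"
  shows "(card (w \<inter> X), card (w \<inter> Y), card (w \<inter> Z)) \<in>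
    {(2, 2, 4), (2, 4, 2), (4, 2, 2), (2, 4, 4), (4, 2, 4), (4, 4, 2), (4, 4, 4), (6, 4, 4), (4, 6, 4), (4, 4, 6)}"
proof -
  have C: "w \<in> C" and e: "even (card (w \<inter> X))" "even (card (w \<inter> Y))" "even (card (w \<inter> Z))"
    using w by (simp_all add: block_even_def)
  have t: "(Y \<union> Z) \<inter> Y = Y" "(X \<union> Z) \<inter> Z = Z" "(X \<union> Y) \<inter> Y = Y" using disj by auto
  have "w \<notin> plane"
    using w t card_blocks m by (auto simp: plane_def block_even_def)
  note b = block_bounds[OF C this]
  have "card (w \<inter> X) \<le> 7" "card (w \<inter> Y) \<le> 7" "card (w \<inter> Z) \<le> 7"
    using card_block_le YZX.card_block_le ZXY.card_block_le m by simp_all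
  then have "card (w \<inter> X) \<in> {0, 2, 4, 6}" "card (w \<inter> Y) \<in> {0, 2, 4, 6}" "card (w \<inter> Z) \<in> {0, 2, 4, 6}"
    using e by (simp_all, presburger+)
  then show ?thesis using b m by (elim insertE emptyE) simp_all
qed

lemma block_even_weights:
  assumes "m = 7" "w \<in> block_even" "w \<noteq> {}"
  shows "card w \<in> {8, 10, 12, 14}"
  using block_even_types[OF assms] weight_eq[OF block_even_word[OF assms(2)]] by auto

lemma block_even_separate:
  assumes m: "m = 7" and "i \<in> X" "j \<in> X" "i \<noteq> j"
  shows "\<exists>c\<in>block_even. i \<in> c \<and> j \<notin> c"
proof -
  have "card {i, j} < card X" using assms card_blocks by simp
  then obtain l where l: "l \<in> X" "l \<noteq> i" "l \<noteq> j"
    by (metis card_mono finite.emptyI finite.insertI insert_iff not_less subsetI)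
  then have "{i, l} \<subseteq> X" "even (card {i, l})" using assms by auto
  then obtain c where "c \<in> block_even" "c \<inter> X = {i, l}" by (rule even_trace[OF m])
  then show ?thesis using l assms by (intro bexI[of _ c]) auto
qed

lemma sum_dev_block_even:
  assumes m: "m = 7"
  shows "(\<Sum>c\<in>block_even. dev X c) = 0" "(\<Sum>c\<in>block_even. (dev X c)\<^sup>2) = 448"
proof -
  have "\<exists>c\<in>block_even. i \<in> c" if "i \<in> X" for i
  proof -
    have "\<exists>j\<in>X. i \<noteq> j"
    proof (rule ccontr)
      assume "\<not> ?thesis"
      then have "X \<subseteq> {i}" by auto
      from card_mono[OF _ this] show False using card_blocks m by simp
    qed
    then show ?thesis using block_even_separate[OF m that] by blast
  qed
  then show "(\<Sum>c\<in>block_even. dev X c) = 0"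
    by (intro sum_dev finite_block_even linear_block_even fin)
  show "(\<Sum>c\<in>block_even. (dev X c)\<^sup>2) = 448"
    using sum_dev_square[OF finite_block_even linear_block_even fin(1) block_even_separate[OF m]]
      card_blocks m card_block_even by simp
qed

end

section \<open>Weight distribution for \<open>m = 7\<close>\<close>

context three_blocks
begin

interpretation YZX: three_blocks C Y Z X m by (rule rotate)
interpretation ZXY: three_blocks C Z X Y m by (rule YZX.rotate)

definition of_weight :: "nat \<Rightarrow> 'a set set" where
  "of_weight n = {w \<in> block_even. card w = n}"

lemma sum_of_weight: "(\<Sum>w\<in>block_even. of_bool (card w = n)) = int (card (of_weight n))"
  using finite_block_even by (simp add: of_weight_def Int_def conj_commute)

text \<open>The mixed third moment \<open>64 * t\<close> gives
  \<open>card (of_weight 10) = 8 * t + 7\<close>; the second moments give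
  \<open>card (of_weight 10) + 2 * card (of_weight 12) = 21\<close>.\<close>

lemma weight_counts:
  assumes m: "m = 7"
  shows "card (of_weight 10) \<le> 21" "card (of_weight 14) = 21" "card (of_weight 10) mod 8 = 7"
proof -
  let ?l = "\<lambda>w. dev X w + dev Y w + dev Z w"
  let ?q = "\<lambda>w. (dev X w)\<^sup>2 + (dev Y w)\<^sup>2 + (dev Z w)\<^sup>2"
  let ?p = "\<lambda>w. dev X w * dev Y w * dev Z w"
  have l: "(\<Sum>w\<in>block_even. ?l w) = 0"
    using sum_dev_block_even(1) YZX.sum_dev_block_even(1) ZXY.sum_dev_block_even(1) m
    by (simp add: sum.distrib block_even_rotate)
  have q: "(\<Sum>w\<in>block_even. ?q w) = 1344"
    using sum_dev_block_even(2) YZX.sum_dev_block_even(2) ZXY.sum_dev_block_even(2) m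
    by (simp add: sum.distrib block_even_rotate)
  obtain t where t: "(\<Sum>w\<in>block_even. ?p w) = 64 * int t"
    using sum_dev_triple[OF finite_block_even linear_block_even fin] card_block_even[OF m]
    by (metis mult.commute of_nat_numeral)
  have e: "(\<Sum>w\<in>block_even. of_bool (w = {})) = (1::int)"
    using finite_block_even linear_familyD(1)[OF linear_block_even] by simp
  \<comment> \<open>On the possible block types, the weight indicators are affine functions of \<open>?l\<close>, \<open>?q\<close>, \<open>?p\<close>.\<close>
  have pt: "4 * ?p w = 32 * of_bool (card w = 10) + 1568 * of_bool (w = {}) - 7 - 2 * ?l w - ?q w \<and>
      32 * of_bool (card w = 10) + 64 * of_bool (card w = 12) =
        67 + 416 * of_bool (w = {}) - 2 * ?l w - 3 * ?q w \<and>
      32 * of_bool (card w = 14) = ?q w - 9 - 96 * of_bool (w = {}) - 2 * ?l w"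
    if w: "w \<in> block_even" for w
  proof (cases "w = {}")
    case True
    then show ?thesis using card_blocks m by (simp add: dev_def)
  next
    case False
    have "card w = card (w \<inter> X) + card (w \<inter> Y) + card (w \<inter> Z)"
      using weight_eq[OF block_even_word[OF w]] .
    then show ?thesis
      using block_even_types[OF m w False] card_blocks m False by (auto simp: dev_def)
  qed
  have one: "(\<Sum>w\<in>block_even. (1::int)) = 64" using card_block_even[OF m] by simp
  have "(\<Sum>w\<in>block_even. 4 * ?p w) = (\<Sum>w\<in>block_even.
      32 * of_bool (card w = 10) + 1568 * of_bool (w = {}) - 7 * 1 - 2 * ?l w - ?q w)"
    using pt by (intro sum.cong) auto
  also have "\<dots> = 32 * int (card (of_weight 10)) + 1568 * 1 - 7 * 64 - 2 * 0 - 1344"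
    unfolding sum.distrib[of "\<lambda>w. 32 * of_bool (card w = 10)"] sum_subtractf
      sum_distrib_left[symmetric] l q e one sum_of_weight ..
  finally have 1: "4 * (64 * int t) = 32 * int (card (of_weight 10)) + 1568 - 448 - 1344"
    by (simp add: t flip: sum_distrib_left)
  then have "card (of_weight 10) = 8 * t + 7" by linarith
  then show "card (of_weight 10) mod 8 = 7" by simp
  have "(\<Sum>w\<in>block_even. 32 * of_bool (card w = 10) + 64 * of_bool (card w = 12)) =
      (\<Sum>w\<in>block_even. 67 * 1 + 416 * of_bool (w = {}) - 2 * ?l w - 3 * ?q w)"
    using pt by (intro sum.cong) auto
  also have "\<dots> = 67 * 64 + 416 * 1 - 2 * 0 - 3 * 1344"
    unfolding sum.distrib[of "\<lambda>w. 67 * 1"] sum_subtractf sum_distrib_left[symmetric] l q e one ..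
  finally have "32 * int (card (of_weight 10)) + 64 * int (card (of_weight 12)) = 672"
    unfolding sum.distrib[of "\<lambda>w. 32 * of_bool (card w = 10)"] sum_distrib_left[symmetric] sum_of_weight
    by simp
  then show "card (of_weight 10) \<le> 21" by linarith
  have "(\<Sum>w\<in>block_even. 32 * of_bool (card w = 14)) =
      (\<Sum>w\<in>block_even. ?q w - 9 * 1 - 96 * of_bool (w = {}) - 2 * ?l w)"
    using pt by (intro sum.cong) auto
  also have "\<dots> = 1344 - 9 * 64 - 96 * 1 - 2 * 0"
    unfolding sum_subtractf sum_distrib_left[symmetric] l q e one ..
  finally show "card (of_weight 14) = 21"
    unfolding sum_distrib_left[symmetric] sum_of_weight by simp
qed

text \<open>A word of \<open>block_even\<close> is the sum of the \<open>f i\<close> over its trace on \<open>X\<close>.\<close>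

lemma frame_parity:
  assumes m: "m = 7" and f: "\<And>i. i \<in> X \<Longrightarrow> f i \<in> block_even \<and> f i \<inter> X = X - {i}"
    and g: "finite g" and "w \<in> block_even"
  shows "even (card (w \<inter> g)) \<longleftrightarrow> even (\<Sum>j\<in>w \<inter> X. card (f j \<inter> g))"
  using assms(4)
proof (induction "card (w \<inter> X)" arbitrary: w rule: less_induct)
  case less
  show ?case
  proof (cases "w \<inter> X = {}")
    case True
    then show ?thesis using block_even_trace_empty[OF m less.prems] by simp
  next
    case False
    then obtain j where j: "j \<in> w \<inter> X" by blast
    \<comment> \<open>A nonempty even trace has two points \<open>j\<close> and \<open>l\<close>;
      adding \<open>f j\<close> and \<open>f l\<close> removes exactly these.\<close>
    have "even (card (w \<inter> X))" using less.prems by (simp add: block_even_def)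
    then have "w \<inter> X \<noteq> {j}" by auto
    then obtain l where l: "l \<in> w \<inter> X" "l \<noteq> j" using j by blast
    let ?e = "sym_diff (f j) (f l)"
    let ?v = "sym_diff w ?e"
    have fj: "f j \<in> block_even" "f l \<in> block_even" using f j l by auto
    have eB: "?e \<in> block_even" using linear_familyD(2)[OF linear_block_even fj] .
    have v: "?v \<in> block_even" using linear_familyD(2)[OF linear_block_even less.prems eB] .
    have tr: "?v \<inter> X = w \<inter> X - {j, l}"
    proof -
      have "?v \<inter> X = sym_diff (w \<inter> X) (sym_diff (f j \<inter> X) (f l \<inter> X))" by auto
      also have "\<dots> = sym_diff (w \<inter> X) (sym_diff (X - {j}) (X - {l}))" using f j l by simp
      also have "\<dots> = w \<inter> X - {j, l}" using j l by auto
      finally show ?thesis .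
    qed
    have wX: "w \<inter> X = insert j (insert l (?v \<inter> X))" "j \<notin> insert l (?v \<inter> X)" "l \<notin> ?v \<inter> X"
      unfolding tr using j l by auto
    have "card (?v \<inter> X) < card (w \<inter> X)"
      unfolding tr using j fin(1) by (intro psubset_card_mono) auto
    then have IH: "even (card (?v \<inter> g)) \<longleftrightarrow> even (\<Sum>j\<in>?v \<inter> X. card (f j \<inter> g))"
      using less.hyps v by blast
    have "even (card (?v \<inter> g)) \<longleftrightarrow>
        (even (card (w \<inter> g)) \<longleftrightarrow> (even (card (f j \<inter> g)) \<longleftrightarrow> even (card (f l \<inter> g))))"
      using even_card_Int_sym_diff block_even_word less.prems eB fj by metis
    moreover have "(\<Sum>j\<in>w \<inter> X. card (f j \<inter> g)) =
        card (f j \<inter> g) + (card (f l \<inter> g) + (\<Sum>j\<in>?v \<inter> X. card (f j \<inter> g)))"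
      unfolding wX(1) using wX(2,3) fin(1) by (simp del: Un_iff)
    ultimately show ?thesis using IH by (simp del: Un_iff) blast
  qed
qed

text \<open>
  The words \<open>f i + f j\<close> have weight 8 or 10, and 10 exactly if \<open>f i\<close> and \<open>f j\<close> meet oddly. For fixed \<open>i\<close> the
  number of such \<open>j\<close> is even, since the \<open>f j\<close> sum to zero. It is positive, since otherwise \<open>f i\<close>
  is orthogonal to all of \<open>block_even\<close>: adding \<open>f i\<close> then exchanges the weights 0 and 2 modulo 4,
  which forces 11 words of weight 10.
\<close>

lemma light_pairs:
  assumes m: "m = 7"
  shows "7 \<le> card {w \<in> of_weight 10. card (w \<inter> X) = 2}"
proof -
  have "\<exists>w. w \<in> block_even \<and> w \<inter> X = X - {i}" if "i \<in> X" for i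
  proof -
    have "even (card (X - {i}))" using that card_blocks m fin by simp
    then show ?thesis using even_trace[OF m, of "X - {i}"] by blast
  qed
  then obtain f where f: "\<And>i. i \<in> X \<Longrightarrow> f i \<in> block_even \<and> f i \<inter> X = X - {i}" by metis
  \<comment> \<open>Six points in \<open>X\<close> occur only in the type
    \<open>(6, 4, 4)\<close>.\<close>
  have f14: "card (f i) = 14" if "i \<in> X" for i
  proof -
    have six: "card (f i \<inter> X) = 6" using f[OF that] that card_blocks m fin by simp
    then have "f i \<noteq> {}" by auto
    then show ?thesis
      using block_even_types[OF m, of "f i"] f[OF that] six weight_eq[OF block_even_word] by auto
  qed
  define J where "J i = {j \<in> X - {i}. odd (card (f j \<inter> f i))}" for i
  have finf: "finite (f i)" if "i \<in> X" for i using finite_word block_even_word f that by blast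
  have evenJ: "even (card (J i))" if i: "i \<in> X" for i
  proof -
    \<comment> \<open>Here \<open>f i\<close> is both the word and the test set: it is the sum of
      the other \<open>f j\<close>, and its weight 14 is even.\<close>
    have "even (\<Sum>j\<in>f i \<inter> X. card (f j \<inter> f i))"
      using frame_parity[OF m f finf[OF i], of "f i"] f[OF i] f14[OF i] by simp
    moreover have "f i \<inter> X = X - {i}" using f[OF i] by simp
    ultimately show ?thesis using fin(1) by (simp add: even_sum_iff J_def)
  qed
  have J_ne: "J i \<noteq> {}" if i: "i \<in> X" for i
  proof
    assume "J i = {}"
    then have ev: "even (card (f j \<inter> f i))" if "j \<in> X" for j
      using that f14[OF i] by (cases "j = i") (auto simp: J_def)
    have meet: "even (card (w \<inter> f i))" if "w \<in> block_even" for w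
    proof -
      have "even (\<Sum>j\<in>w \<inter> X. card (f j \<inter> f i))" using ev by (intro dvd_sum) auto
      then show ?thesis using frame_parity[OF m f finf[OF i] that] by simp
    qed
    have ar: "a mod 4 = (c + 2) mod 4" if abc: "a + 2 * b = 14 + c" "even b" for a b c :: nat
    proof -
      obtain d where "b = 2 * d" using abc(2) by (rule evenE)
      then have "(a + d * 4) mod 4 = (c + 2 + 3 * 4) mod 4" using abc(1) by (simp add: algebra_simps)
      then show ?thesis unfolding mod_mult_self1 .
    qed
    have shift: "card (sym_diff (f i) w) mod 4 = (card w + 2) mod 4" if "w \<in> block_even" for w
    proof -
      have "card (sym_diff (f i) w) + 2 * card (w \<inter> f i) = 14 + card w"
        using card_sym_diff_int[OF finf[OF i] finite_word[OF block_even_word[OF that]]] f14[OF i]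
        by (simp add: Int_commute)
      then show ?thesis using meet[OF that] by (rule ar)
    qed
    let ?A = "{w \<in> block_even. card w mod 4 = 0}" and ?B = "{w \<in> block_even. card w mod 4 = 2}"
    have cl: "sym_diff (f i) w \<in> block_even" if "w \<in> block_even" for w
      using linear_familyD(2)[OF linear_block_even _ that] f i by blast
    have "bij_betw (sym_diff (f i)) ?A ?B"
    proof (rule bij_betw_byWitness[where f' = "sym_diff (f i)"])
      have "(a + 2) mod 4 = 2" if "a mod 4 = 0" for a :: nat using that by presburger
      then show "sym_diff (f i) ` ?A \<subseteq> ?B" using cl shift by (simp add: image_subset_iff)
      have "(a + 2) mod 4 = 0" if "a mod 4 = 2" for a :: nat using that by presburger
      then show "sym_diff (f i) ` ?B \<subseteq> ?A" using cl shift by (simp add: image_subset_iff)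
    qed (auto simp: sym_diff_cancel)
    then have AB: "card ?A = card ?B" by (rule bij_betw_same_card)
    have "block_even = ?A \<union> ?B"
      using block_even_weights[OF m] by force
    then have "card block_even = card ?A + card ?B"
      using finite_block_even by (subst card_Un_disjoint[symmetric]) auto
    moreover have "?B = of_weight 10 \<union> of_weight 14"
      using block_even_weights[OF m] by (force simp: of_weight_def)
    then have "card ?B = card (of_weight 10) + card (of_weight 14)"
      using finite_block_even by (subst card_Un_disjoint[symmetric]) (auto simp: of_weight_def)
    \<comment> \<open>\<open>?B\<close> has 32 of the 64 words, and 21 of them have weight 14; the
      remaining 11 is 3 modulo 8, not 7.\<close>
    ultimately have "card (of_weight 10) = 11"
      using AB card_block_even[OF m] weight_counts(2)[OF m] by simp
    then show False using weight_counts(3)[OF m] by simp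
  qed
  have J2: "2 \<le> card (J i)" if "i \<in> X" for i
  proof -
    have "card (J i) \<noteq> 0" using J_ne[OF that] fin(1) by (simp add: J_def)
    then show ?thesis using evenJ[OF that] by presburger
  qed
  let ?P = "{w \<in> of_weight 10. card (w \<inter> X) = 2}"
  have finP: "finite ?P" using finite_block_even by (simp add: of_weight_def)
  have deg: "2 \<le> card {w \<in> ?P. i \<in> w}" if i: "i \<in> X" for i
  proof -
    have tr: "sym_diff (f i) (f j) \<inter> X = {i, j}" if "j \<in> X" "j \<noteq> i" for j
    proof -
      have "sym_diff (f i) (f j) \<inter> X = sym_diff (f i \<inter> X) (f j \<inter> X)" by auto
      also have "\<dots> = sym_diff (X - {i}) (X - {j})" using f i that by simp
      also have "\<dots> = {i, j}" using i that by auto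
      finally show ?thesis .
    qed
    have "inj_on (\<lambda>j. sym_diff (f i) (f j)) (J i)"
    proof (rule inj_onI)
      fix j l assume "j \<in> J i" "l \<in> J i" "sym_diff (f i) (f j) = sym_diff (f i) (f l)"
      then have "{i, j} = {i, l}" "j \<noteq> i" "l \<noteq> i" using tr[of j] tr[of l] by (auto simp: J_def)
      then show "j = l" by auto
    qed
    \<comment> \<open>An odd intersection makes the weight
      \<open>28 - 2 * card (f j \<inter> f i)\<close> congruent to 2 modulo 4. Two-point traces
      allow only 8 and 10, so it is 10.\<close>
    moreover have "sym_diff (f i) (f j) \<in> {w \<in> ?P. i \<in> w}" if j: "j \<in> J i" for j
    proof -
      let ?e = "sym_diff (f i) (f j)"
      have jX: "j \<in> X" "j \<noteq> i" "odd (card (f j \<inter> f i))" using j by (auto simp: J_def)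
      have e: "?e \<in> block_even" using linear_familyD(2)[OF linear_block_even] f i jX by blast
      have tre: "?e \<inter> X = {i, j}" using tr jX by blast
      then have two: "card (?e \<inter> X) = 2" using jX by simp
      then have "?e \<noteq> {}" by (metis card.empty inf_bot_left zero_neq_numeral)
      have "card ?e + 2 * card (f j \<inter> f i) = 28"
        using card_sym_diff_int[OF finf[OF i] finf[OF jX(1)]] f14 i jX by (simp add: Int_commute)
      moreover have "a mod 4 = 2" if ab: "a + 2 * b = 28" "odd b" for a b :: nat
      proof -
        obtain d where "b = 2 * d + 1" using ab(2) by (rule oddE)
        then have "(a + d * 4) mod 4 = 26 mod 4" using ab(1) by (simp add: algebra_simps)
        then show ?thesis unfolding mod_mult_self1 by simp
      qed
      ultimately have "card ?e mod 4 = 2" using jX(3) by blast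
      moreover have "card ?e \<in> {8, 10}"
        using block_even_types[OF m e \<open>?e \<noteq> {}\<close>] weight_eq[OF block_even_word[OF e]] two
        by (auto simp del: Un_iff)
      ultimately have "card ?e = 10" by auto
      then show ?thesis using e two tre by (auto simp: of_weight_def simp del: Un_iff)
    qed
    moreover have "finite {w \<in> ?P. i \<in> w}" using finP by (rule rev_finite_subset) auto
    ultimately have "card (J i) \<le> card {w \<in> ?P. i \<in> w}"
      by (intro card_inj_on_le[where f = "\<lambda>j. sym_diff (f i) (f j)"]) auto
    then show ?thesis using J2[OF i] by simp
  qed
  \<comment> \<open>Double counting: each of 7 points lies in at least two words of
    \<open>?P\<close>, and each such word has two points in \<open>X\<close>.\<close>
  have "14 = (\<Sum>i\<in>X. 2 :: nat)" using card_blocks m by simp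
  also have "\<dots> \<le> (\<Sum>i\<in>X. card {w \<in> ?P. i \<in> w})" using deg by (intro sum_mono)
  also have "\<dots> = (\<Sum>i\<in>X. \<Sum>w\<in>?P. of_bool (i \<in> w))"
    using finP by (intro sum.cong) (simp_all add: Int_def)
  also have "\<dots> = (\<Sum>w\<in>?P. \<Sum>i\<in>X. of_bool (i \<in> w))" by (rule sum.swap)
  also have "\<dots> = (\<Sum>w\<in>?P. card (w \<inter> X))"
    using fin(1) by (intro sum.cong) (simp_all add: Int_commute)
  also have "\<dots> = 2 * card ?P" by simp
  finally show ?thesis by simp
qed

end

context three_blocks
begin

interpretation YZX: three_blocks C Y Z X m by (rule rotate)
interpretation ZXY: three_blocks C Z X Y m by (rule YZX.rotate)

lemma of_weight_rotate: "YZX.of_weight = of_weight" "ZXY.of_weight = of_weight"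
  by (simp_all add: fun_eq_iff of_weight_def YZX.of_weight_def ZXY.of_weight_def block_even_rotate)

text \<open>A word of weight 10 has exactly one block weight 2, so \<open>light_pairs\<close> and
  its rotations give three disjoint sets of at least 7 words. The count is then 21, which is 5
  modulo 8 instead of 7.\<close>

lemma dim_ne_7: "m \<noteq> 7"
proof
  assume m: "m = 7"
  let ?P = "\<lambda>B. {w \<in> of_weight 10. card (w \<inter> B) = 2}"
  have fin10: "finite (of_weight 10)" using finite_block_even by (simp add: of_weight_def)
  have one: "\<not> (card (w \<inter> X) = 2 \<and> card (w \<inter> Y) = 2) \<and> \<not> (card (w \<inter> X) = 2 \<and> card (w \<inter> Z) = 2) \<and>
      \<not> (card (w \<inter> Y) = 2 \<and> card (w \<inter> Z) = 2)" if "w \<in> of_weight 10" for w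
  proof -
    have w: "w \<in> block_even" "card w = 10" "w \<noteq> {}" using that by (auto simp: of_weight_def)
    show ?thesis using block_even_types[OF m w(1,3)] weight_eq[OF block_even_word[OF w(1)]] w(2) by auto
  qed
  have "card (?P X \<union> ?P Y) = card (?P X) + card (?P Y)"
    using fin10 one by (intro card_Un_disjoint) auto
  moreover have "card ((?P X \<union> ?P Y) \<union> ?P Z) = card (?P X \<union> ?P Y) + card (?P Z)"
    using fin10 one by (intro card_Un_disjoint) auto
  moreover have "card ((?P X \<union> ?P Y) \<union> ?P Z) \<le> card (of_weight 10)"
    using fin10 by (intro card_mono) auto
  moreover have "7 \<le> card (?P X)" "7 \<le> card (?P Y)" "7 \<le> card (?P Z)"
    using light_pairs[OF m] YZX.light_pairs[OF m] ZXY.light_pairs[OF m] by (simp_all add: of_weight_rotate)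
  ultimately have "card (of_weight 10) = 21" using weight_counts(1)[OF m] by linarith
  then show False using weight_counts(3)[OF m] by simp
qed

end

section \<open>Codes as families of supports\<close>

text \<open>Coefficient functions on a basis inject into the carrier through \<open>lincomb\<close>;
  a finite carrier spans itself, so a finite basis exists.\<close>

lemma (in vectorspace) card_carrier_ge:
  assumes fin: "finite (carrier V)" and two: "card (carrier K) = 2"
  shows "2 ^ dim \<le> card (carrier V)"
proof -
  have "span (carrier V) = carrier V"
    using in_own_span[of "carrier V"] span_is_subset2[of "carrier V"] by auto
  then have "fin_dim" unfolding fin_dim_def using fin by blast
  then obtain B where B: "finite B" "basis B" using finite_basis_exists by blast
  have BV: "B \<subseteq> carrier V" using B(2) by (simp add: basis_def)
  let ?F = "B \<rightarrow>\<^sub>E carrier K"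
  have uniq: "\<exists>!a. a \<in> ?F \<and> lincomb a B = v" if "v \<in> carrier V" for v
    using basis_criterion[OF B(1) BV] B(2) that by blast
  have cl: "lincomb a B \<in> carrier V" if "a \<in> ?F" for a
    using that BV by (intro lincomb_closed) (auto simp: PiE_def)
  have "inj_on (\<lambda>a. lincomb a B) ?F"
    using uniq cl by (intro inj_onI) metis
  moreover have "(\<lambda>a. lincomb a B) ` ?F \<subseteq> carrier V" using cl by blast
  ultimately have "card ?F \<le> card (carrier V)" using fin card_inj_on_le by blast
  moreover have "card ?F = 2 ^ card B" using B(1) two by (simp add: card_PiE)
  ultimately show ?thesis using dim_basis[OF B] by simp
qed

lemma vec_support_add:
  assumes "x \<in> carrier_vec n" "y \<in> carrier_vec n"
  shows "vec_support (x + y) = sym_diff (vec_support x) (vec_support y)"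
proof -
  have "x $ i + y $ i = 1 \<longleftrightarrow> (x $ i = 1) \<noteq> (y $ i = 1)" for i
    by (cases "x $ i"; cases "y $ i") simp_all
  then show ?thesis using assms by (auto simp: vec_support_def)
qed

lemma vec_support_zero: "vec_support (0\<^sub>v n) = {}"
  by (auto simp: vec_support_def)

lemma vec_support_subset: "x \<in> carrier_vec n \<Longrightarrow> vec_support x \<subseteq> {..<n}"
  by (auto simp: vec_support_def)

lemma inj_on_vec_support: "inj_on vec_support (carrier_vec n)"
proof (rule inj_onI)
  fix x y :: "bit vec"
  assume xy: "x \<in> carrier_vec n" "y \<in> carrier_vec n" "vec_support x = vec_support y"
  show "x = y"
  proof (rule eq_vecI)
    fix i assume "i < dim_vec y"
    then have "x $ i = 1 \<longleftrightarrow> y $ i = 1" using xy by (auto simp: vec_support_def set_eq_iff)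
    then show "x $ i = y $ i" by (metis bit_not_one_iff)
  qed (use xy in auto)
qed

lemma vec_support_eq_empty_iff:
  "x \<in> carrier_vec n \<Longrightarrow> vec_support x = {} \<longleftrightarrow> x = 0\<^sub>v n"
  using inj_on_vec_support[of n] vec_support_zero[of n] by (metis inj_onD zero_carrier_vec)

lemma binary_codeD:
  assumes "binary_code n k C"
  shows "C \<subseteq> carrier_vec n" "0\<^sub>v n \<in> C" "x \<in> C \<Longrightarrow> y \<in> C \<Longrightarrow> x + y \<in> C" "2 ^ k \<le> card C"
proof -
  have sub: "VectorSpace.subspace class_ring C (module_vec TYPE(bit) n)"
    and dim: "vectorspace.dim class_ring ((module_vec TYPE(bit) n)\<lparr>carrier := C\<rparr>) = k"
    using assms by (auto simp: binary_code_def)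
  interpret submodule class_ring C "module_vec TYPE(bit) n"
    using sub by (simp add: VectorSpace.subspace_def)
  show C: "C \<subseteq> carrier_vec n" using subset by (simp add: module_vec_simps)
  show "0\<^sub>v n \<in> C" using zero_closed by (simp add: module_vec_simps)
  show "x + y \<in> C" if "x \<in> C" "y \<in> C" using m_closed[OF that] by (simp add: module_vec_simps)
  interpret C: vectorspace class_ring "(module_vec TYPE(bit) n)\<lparr>carrier := C\<rparr>"
    using vectorspace.subspace_is_vs[OF vec_vs sub] .
  have "finite (vec_support ` C)"
  proof (rule finite_subset)
    show "vec_support ` C \<subseteq> Pow {..<n}" using vec_support_subset subsetD[OF C] by blast
  qed simp
  then have "finite C"
    using finite_imageD inj_on_subset[OF inj_on_vec_support C] by blast
  moreover have "UNIV = {0, 1 :: bit}" by (auto intro: bit.exhaust)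
  then have "card (UNIV :: bit set) = 2" by (metis card_2_iff zero_neq_one)
  ultimately show "2 ^ k \<le> card C"
    using C.card_carrier_ge dim by simp
qed

lemma support_family:
  assumes code: "binary_code n k C" and min: "minimal_code n C"
  shows "vec_support ` C \<subseteq> Pow {..<n}" "linear_family (vec_support ` C)"
    "intersecting (vec_support ` C)" "2 ^ k \<le> card (vec_support ` C)"
proof -
  note C = binary_codeD[OF code]
  show "vec_support ` C \<subseteq> Pow {..<n}" using vec_support_subset C(1) by blast
  show "linear_family (vec_support ` C)"
    unfolding linear_family_def
  proof (intro conjI ballI)
    show "{} \<in> vec_support ` C" using vec_support_zero C(2) by (metis imageI)
    fix c d assume "c \<in> vec_support ` C" "d \<in> vec_support ` C"
    then obtain x y where "x \<in> C" "y \<in> C" "c = vec_support x" "d = vec_support y" by blast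
    then show "sym_diff c d \<in> vec_support ` C"
      using vec_support_add[of x n y] C by (metis imageI subsetD)
  qed
  have "inj_on vec_support C" using inj_on_subset[OF inj_on_vec_support C(1)] .
  then show "2 ^ k \<le> card (vec_support ` C)" using C(4) by (simp add: card_image)
  show "intersecting (vec_support ` C)"
    unfolding intersecting_def
  proof (intro ballI impI notI)
    fix c d assume cd: "c \<in> vec_support ` C" "d \<in> vec_support ` C" "c \<noteq> {}" "d \<noteq> {}" "c \<inter> d = {}"
    then obtain x y where xy: "x \<in> C" "y \<in> C" "c = vec_support x" "d = vec_support y" by blast
    have car: "x \<in> carrier_vec n" "y \<in> carrier_vec n" "x + y \<in> carrier_vec n" using xy C by auto
    have s: "vec_support (x + y) = sym_diff c d" using vec_support_add car xy by simp
    have "x \<noteq> 0\<^sub>v n" using cd xy vec_support_zero by auto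
    \<comment> \<open>Disjoint supports would place the support of \<open>x\<close> properly inside
      that of the nonzero word \<open>x + y\<close>, which is minimal.\<close>
    moreover have "vec_support x \<subset> vec_support (x + y)" unfolding s using xy cd by blast
    moreover have "x + y \<noteq> 0\<^sub>v n"
      using s cd vec_support_eq_empty_iff[OF car(3)] by blast
    ultimately show False
      using min C(3)[OF xy(1,2)] xy(1) by (auto simp: minimal_code_def minimal_codeword_def)
  qed
qed

text \<open>If the support of \<open>y\<close> lies properly inside that of \<open>x\<close>, then
  \<open>x + y\<close> is nonzero with support disjoint from that of \<open>y\<close>.\<close>

lemma intersecting_imp_minimal:
  assumes code: "binary_code n k C" and int: "intersecting (vec_support ` C)"
  shows "minimal_code n C"
proof -
  note C = binary_codeD[OF code]
  have "\<not> vec_support y \<subset> vec_support x" if xy: "x \<in> C" "y \<in> C" "y \<noteq> 0\<^sub>v n" for x y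
  proof
    assume less: "vec_support y \<subset> vec_support x"
    have car: "x \<in> carrier_vec n" "y \<in> carrier_vec n"
      using C(1) xy(1,2) by blast+
    have s: "vec_support (x + y) = vec_support x - vec_support y"
      unfolding vec_support_add[OF car] using less by auto
    have "vec_support (x + y) \<in> vec_support ` C" "vec_support y \<in> vec_support ` C"
      using C(3)[OF xy(1,2)] xy(2) by (simp_all only: imageI)
    then have "vec_support (x + y) = {} \<or> vec_support y = {}"
      by (rule intersectingD[OF int]) (auto simp: s)
    moreover have "vec_support (x + y) \<noteq> {}" using s less by auto
    ultimately show False using xy(3) vec_support_eq_empty_iff[OF car(2)] by simp
  qed
  then show ?thesis unfolding minimal_code_def minimal_codeword_def by blast
qed

text \<open>
  A word \<open>x\<close> of \<open>F_2^k\<close> is sent to the values \<open>x_i\<close> and \<open>x_i + x_j\<close>: if \<open>i\<close> is in the support of \<open>x\<close> only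
  and \<open>j\<close> in that of \<open>y\<close> only, then \<open>x_i + x_j = y_i + y_j = 1\<close>.
\<close>

definition pair_code :: "nat \<Rightarrow> bit vec \<Rightarrow> bit vec" where
  "pair_code k x =
     vec (k * k) (\<lambda>p. if p div k = p mod k then x $ (p mod k) else x $ (p div k) + x $ (p mod k))"

lemma pair_code_index:
  assumes "i < k" "j < k"
  shows "i * k + j < k * k" "pair_code k x $ (i * k + j) = (if i = j then x $ i else x $ i + x $ j)"
proof -
  have "i * k + j < (i + 1) * k" using assms by simp
  also have "\<dots> \<le> k * k" using assms by (intro mult_right_mono) auto
  finally show lt: "i * k + j < k * k" .
  then show "pair_code k x $ (i * k + j) = (if i = j then x $ i else x $ i + x $ j)"
    using assms by (simp add: pair_code_def)
qed

text \<open>Ensures that the \<open>LEAST\<close> in \<open>min_length_minimal_code\<close> is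
  attained. The diagonal positions recover \<open>x\<close>, so \<open>pair_code k\<close> is
  injective and its image has dimension \<open>k\<close>.\<close>

lemma minimal_code_exists: "\<exists>n C. binary_code n k C \<and> minimal_code n C"
proof -
  let ?V = "module_vec TYPE(bit) k" and ?W = "module_vec TYPE(bit) (k * k)"
  interpret V: vec_space "TYPE(bit)" k .
  have idx: "p div k < k" "p mod k < k" if "p < k * k" for p :: nat
    using that by (auto simp: less_mult_imp_div_less intro!: mod_less_divisor gr0I)
  have add: "pair_code k (x + y) = pair_code k x + pair_code k y"
    if "x \<in> carrier_vec k" "y \<in> carrier_vec k" for x y
    using that idx by (intro eq_vecI) (auto simp: pair_code_def)
  have smult: "pair_code k (r \<cdot>\<^sub>v x) = r \<cdot>\<^sub>v pair_code k x" if "x \<in> carrier_vec k" for r x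
    using that idx by (intro eq_vecI) (auto simp: pair_code_def distrib_left)
  have "pair_code k \<in> LinearCombinations.module_hom class_ring ?V ?W"
    using add smult by (auto simp: LinearCombinations.module_hom_def module_vec_simps pair_code_def)
  then have "linear_map class_ring ?V ?W (pair_code k)"
    by (intro linear_map.intro mod_hom.intro mod_hom_axioms.intro vec_vs vec_module)
  then interpret T: linear_map class_ring ?V ?W "pair_code k" .
  let ?C = "pair_code k ` carrier_vec k"
  have im: "T.im = ?C" by (simp add: T.im_def module_vec_simps)
  have inj: "inj_on (pair_code k) (carrier ?V)"
  proof (rule inj_onI)
    fix x y assume xy: "x \<in> carrier ?V" "y \<in> carrier ?V" "pair_code k x = pair_code k y"
    show "x = y"
    proof (rule eq_vecI)
      fix i assume "i < dim_vec y"
      then have "i < k" using xy by (auto simp: module_vec_simps)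
      then show "x $ i = y $ i" using pair_code_index(2)[of i k i] xy(3) by metis
    qed (use xy in \<open>auto simp: module_vec_simps\<close>)
  qed
  have "vectorspace.dim class_ring (?W\<lparr>carrier := ?C\<rparr>) = k"
    using T.rank_nullity[OF V.fin_dim] T.inj_imp_dim_ker0[OF inj] V.dim_is_n im by simp
  then have code: "binary_code (k * k) k ?C"
    using T.imT_is_subspace im by (simp add: binary_code_def)
  have sup: "i * k + j \<in> vec_support (pair_code k x) \<longleftrightarrow> (if i = j then x $ i else x $ i + x $ j) = 1"
    if "i < k" "j < k" for i j x
    using pair_code_index[OF that] by (simp add: vec_support_def pair_code_def)
  have "intersecting (vec_support ` ?C)"
    unfolding intersecting_def
  proof (intro ballI impI notI)
    fix c d assume cd: "c \<in> vec_support ` ?C" "d \<in> vec_support ` ?C" "c \<noteq> {}" "d \<noteq> {}" "c \<inter> d = {}"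
    then obtain x y where x: "x \<in> carrier_vec k" "c = vec_support (pair_code k x)"
      and y: "y \<in> carrier_vec k" "d = vec_support (pair_code k y)" by blast
    have dis: "\<not> ((if i = j then x $ i else x $ i + x $ j) = 1 \<and> (if i = j then y $ i else y $ i + y $ j) = 1)"
      if "i < k" "j < k" for i j
      using sup[OF that, of x] sup[OF that, of y] x(2) y(2) cd(5) by blast
    have nz: "\<exists>i<k. z $ i = 1" if z: "vec_support (pair_code k z) \<noteq> {}" for z
    proof (rule ccontr)
      assume "\<not> ?thesis"
      then have "z $ i = 0" if "i < k" for i using that by auto
      then have "vec_support (pair_code k z) = {}"
        using idx by (auto simp: vec_support_def pair_code_def)
      then show False using z by simp
    qed
    obtain i where i: "i < k" "x $ i = 1" using nz[of x] cd x by auto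
    obtain j where j: "j < k" "y $ j = 1" using nz[of y] cd y by auto
    \<comment> \<open>Diagonal positions separate the supports of \<open>x\<close> and
      \<open>y\<close>; position \<open>i * k + j\<close> is then 1 in both codewords.\<close>
    have "y $ i = 0" "x $ j = 0" using dis[of i i] dis[of j j] i j by auto
    then show False using dis[of i j] i j by (cases "i = j") auto
  qed
  then show ?thesis using code intersecting_imp_minimal by blast
qed

theorem theoremB:
  fixes k :: nat
  assumes "k > 0"
    and "k \<in> {7, 8, 9, 11} \<or> k mod 8 = 5"
  shows "min_length_minimal_code k \<ge> 3 * (k - 1) + 1"
proof (rule ccontr)
  define m where "m = k - 1"
  define n where "n = min_length_minimal_code k"
  assume "\<not> ?thesis"
  \<comment> \<open>The negated bound reads \<open>n \<le> 3 * (k - 1)\<close>, as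
    \<open>intersecting_length\<close> requires.\<close>
  then have n: "card {..<n} \<le> 3 * m" by (simp add: n_def m_def)
  obtain C where C: "binary_code n k C" "minimal_code n C"
    using LeastI_ex[OF minimal_code_exists[of k]] by (auto simp: n_def min_length_minimal_code_def)
  note F = support_family[OF C]
  have "2 ^ (m + 1) \<le> card (vec_support ` C)" using F(4) assms(1) by (simp add: m_def)
  then obtain X Y Z where "three_blocks (vec_support ` C) X Y Z m"
    using intersecting_length[OF finite_lessThan n F(1,2,3)] by blast
  then interpret three_blocks "vec_support ` C" X Y Z m .
  have k: "k = m + 1" using assms(1) by (simp add: m_def)
  have "m mod 8 = 4 \<Longrightarrow> 2 \<le> m \<and> even m \<and> m mod 4 = 0" by presburger
  moreover have "(m + 1) mod 8 = 5 \<Longrightarrow> m mod 8 = 4" by presburger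
  \<comment> \<open>\<open>k = 9\<close> and \<open>k mod 8 = 5\<close> make \<open>m\<close> a
    multiple of 4; \<open>k = 7, 8, 11\<close> give \<open>m = 6, 7, 10\<close>.\<close>
  ultimately consider "m \<in> {6, 7, 10}" | "2 \<le> m" "even m" "m mod 4 = 0"
    using assms(2) unfolding k by fastforce
  then show False
  proof cases
    case 1
    then show ?thesis using dim_ne_6 dim_ne_7 dim_ne_10 by blast
  next
    case 2
    then show ?thesis using even_dim_mod_4 by simp
  qed
qed

end
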